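(* There exist a Banach space $X$ and a compact linear operator $T\in K(X)$ which cannot be approximated by numerical radius attaining operators; that is, $T$ does not belong to the operator-norm closure of $\mathrm{NRA}(X)$ in $L(X)$.
   Context: Banach spaces are real or complex. For a Banach space $X$: $S_X$ is its unit sphere, $X^*$ its topological dual, $L(X)$ the space of bounded linear operators from $X$ to $X$ with the operator norm, and $K(X)\subset L(X)$ the space of compact linear operators. Put $\Pi(X)=\{(x,x^* )\in X\times X^* : x\in S_X,\ x^*\in S_{X^*},\ x^*(x)=1\}$. The numerical radius of $T\in L(X)$ is $v(T)=\sup\{|x^*(Tx)| : (x,x^* )\in\Pi(X)\}$. The operator $T$ attains its numerical radius if this supremum is a maximum, i.e. there is $(x_0,x_0^* )\in\Pi(X)$ with $|x_0^*(Tx_0)|=v(T)$. $\mathrm{NRA}(X)\subset L(X)$ denotes the set of all operators in $L(X)$ (not necessarily compact) which attain their numerical radius. *)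

theory Defs
  imports "HOL-Analysis.Analysis" "HOL-Library.Function_Algebras"
begin

text \<open>
  HOL cannot quantify over types, so Banach spaces are carried by linear subspaces \<open>X\<close> of an
  ambient \<open>'k\<close>-vector space \<open>'v\<close>, with a norm \<open>N\<close> on \<open>X\<close> that is unrelated to any topology of
  the ambient space. Only the values of \<open>N\<close> on \<open>X\<close> are ever used. The scalar field \<open>'k\<close> is
  intended to be \<^typ>\<open>real\<close> or \<^typ>\<open>complex\<close>.
\<close>

locale normed_space_on = vector_space scale
  for scale :: "'k::real_normed_field \<Rightarrow> 'v::ab_group_add \<Rightarrow> 'v" +
  fixes X :: "'v set" and N :: "'v \<Rightarrow> real"
  assumes subspace_X: "subspace X"
    and N_nonneg: "x \<in> X \<Longrightarrow> 0 \<le> N x"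
    and N_eq_0_iff: "x \<in> X \<Longrightarrow> N x = 0 \<longleftrightarrow> x = 0"
    and N_scale: "x \<in> X \<Longrightarrow> N (scale c x) = norm c * N x"
    and N_triangle: "x \<in> X \<Longrightarrow> y \<in> X \<Longrightarrow> N (x + y) \<le> N x + N y"
begin

text \<open>The off-carrier value only serves to meet the global axioms of \<^locale>\<open>Metric_space\<close>.\<close>

definition vec_dist :: "'v \<Rightarrow> 'v \<Rightarrow> real" where
  "vec_dist x y = (if x \<in> X \<and> y \<in> X then N (x - y) else 0)"

definition unit_ball :: "'v set" where
  "unit_ball = {x \<in> X. N x \<le> 1}"

definition unit_sphere :: "'v set" where
  "unit_sphere = {x \<in> X. N x = 1}"

text \<open>
  Maps are taken extensional on \<open>X\<close>, so that two maps are equal iff they agree on \<open>X\<close>.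
\<close>

definition bounded_linear_maps ::
    "('k \<Rightarrow> 'w::ab_group_add \<Rightarrow> 'w) \<Rightarrow> 'w set \<Rightarrow> ('w \<Rightarrow> real) \<Rightarrow> ('v \<Rightarrow> 'w) set" where
  "bounded_linear_maps t Y M =
    {f \<in> X \<rightarrow>\<^sub>E Y.
       (\<forall>x\<in>X. \<forall>y\<in>X. f (x + y) = f x + f y) \<and>
       (\<forall>c. \<forall>x\<in>X. f (scale c x) = t c (f x)) \<and>
       (\<exists>B. \<forall>x\<in>X. M (f x) \<le> B * N x)}"

definition map_norm :: "('w \<Rightarrow> real) \<Rightarrow> ('v \<Rightarrow> 'w) \<Rightarrow> real" where
  "map_norm M f = (SUP x\<in>unit_ball. M (f x))"

definition dual :: "('v \<Rightarrow> 'k) set" where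
  "dual = bounded_linear_maps (*) UNIV norm"

definition dual_sphere :: "('v \<Rightarrow> 'k) set" where
  "dual_sphere = {f \<in> dual. map_norm norm f = 1}"

definition operators :: "('v \<Rightarrow> 'v) set" where
  "operators = bounded_linear_maps scale X N"

definition op_dist :: "('v \<Rightarrow> 'v) \<Rightarrow> ('v \<Rightarrow> 'v) \<Rightarrow> real" where
  "op_dist S T = (if S \<in> operators \<and> T \<in> operators then map_norm N (\<lambda>x. S x - T x) else 0)"

lemma X_diff: "x \<in> X \<Longrightarrow> y \<in> X \<Longrightarrow> x - y \<in> X"
  using subspace_X by (rule subspace_diff)

lemma N_minus: "x \<in> X \<Longrightarrow> N (- x) = N x"
  using N_scale[of x "- 1"] by (simp add: scale_minus_left)

lemma N_minus_commute: "x \<in> X \<Longrightarrow> y \<in> X \<Longrightarrow> N (x - y) = N (y - x)"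
  using N_minus[OF X_diff[of x y]] by simp

sublocale vec: Metric_space X vec_dist
proof
  fix x y z
  show "0 \<le> vec_dist x y"
    by (simp add: vec_dist_def N_nonneg X_diff)
  show "vec_dist x y = vec_dist y x"
    by (simp add: vec_dist_def N_minus_commute)
  show "vec_dist x y = 0 \<longleftrightarrow> x = y" if "x \<in> X" "y \<in> X"
    using that by (simp add: vec_dist_def N_eq_0_iff X_diff)
  show "vec_dist x z \<le> vec_dist x y + vec_dist y z" if "x \<in> X" "y \<in> X" "z \<in> X"
    using that N_triangle[OF X_diff[of x y] X_diff[of y z]] by (simp add: vec_dist_def)
qed

lemma zero_in_unit_ball: "0 \<in> unit_ball"
  using N_eq_0_iff[of 0] subspace_0[OF subspace_X] by (simp add: unit_ball_def)

lemma operator_diff_bdd: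
  assumes "S \<in> operators" "T \<in> operators"
  shows "bdd_above ((\<lambda>x. N (S x - T x)) ` unit_ball)"
proof -
  obtain B where B: "\<And>x. x \<in> X \<Longrightarrow> N (S x) \<le> B * N x"
    using assms(1) unfolding operators_def bounded_linear_maps_def by blast
  obtain C where C: "\<And>x. x \<in> X \<Longrightarrow> N (T x) \<le> C * N x"
    using assms(2) unfolding operators_def bounded_linear_maps_def by blast
  have "N (S x - T x) \<le> \<bar>B\<bar> + \<bar>C\<bar>" if "x \<in> unit_ball" for x
  proof -
    have x: "x \<in> X" "N x \<le> 1" "0 \<le> N x" using that N_nonneg by (auto simp: unit_ball_def)
    have ST: "S x \<in> X" "T x \<in> X"
      using assms x by (auto simp: operators_def bounded_linear_maps_def)
    have le: "D * N x \<le> \<bar>D\<bar>" for D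
      using x mult_mono[of D "\<bar>D\<bar>" "N x" 1] by simp
    have "N (S x - T x) \<le> N (S x) + N (T x)"
      using N_triangle[of "S x" "- T x"] ST N_minus subspace_neg[OF subspace_X] by simp
    also have "\<dots> \<le> B * N x + C * N x" using B C x by (simp add: add_mono)
    also have "\<dots> \<le> \<bar>B\<bar> + \<bar>C\<bar>" by (intro add_mono le)
    finally show ?thesis .
  qed
  then show ?thesis by (rule bdd_aboveI2)
qed

lemma operator_scale_sphere:
  assumes "S \<in> operators" "T \<in> operators" "x \<in> X" "\<And>y. y \<in> unit_ball \<Longrightarrow> S y = T y"
  shows "S x = T x"
proof (cases "x = 0")
  case True
  then show ?thesis using assms zero_in_unit_ball by simp
next
  case False
  define c where "c = (of_real (N x) :: 'k)"
  have N: "N x > 0" using False assms N_nonneg[of x] N_eq_0_iff[of x] by auto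
  then have c: "c \<noteq> 0" by (simp add: c_def)
  define y where "y = scale (inverse c) x"
  have y: "y \<in> X" using subspace_scale[OF subspace_X] assms by (simp add: y_def)
  have "N y = 1" using N N_scale[OF assms(3)] by (simp add: y_def c_def norm_inverse)
  then have "S y = T y" using y assms by (simp add: unit_ball_def)
  moreover have "x = scale c y" using c by (simp add: y_def)
  moreover have "S (scale c y) = scale c (S y)" "T (scale c y) = scale c (T y)"
    using assms y by (simp_all add: operators_def bounded_linear_maps_def)
  ultimately show ?thesis by simp
qed

sublocale op: Metric_space operators op_dist
proof
  fix S T U
  have in_X: "V x \<in> X" if "V \<in> operators" "x \<in> unit_ball" for V x
    using that by (auto simp: operators_def bounded_linear_maps_def unit_ball_def)
  have upper: "N (V x - W x) \<le> op_dist V W"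
    if "V \<in> operators" "W \<in> operators" "x \<in> unit_ball" for V W x
    using that by (auto simp: op_dist_def map_norm_def intro!: cSUP_upper operator_diff_bdd)
  show "0 \<le> op_dist S T"
  proof (cases "S \<in> operators \<and> T \<in> operators")
    case True
    then show ?thesis
      using upper[OF _ _ zero_in_unit_ball, of S T]
        N_nonneg[OF X_diff[OF in_X[OF _ zero_in_unit_ball, of S] in_X[OF _ zero_in_unit_ball, of T]]]
      by simp
  qed (auto simp: op_dist_def)
  show "op_dist S T = op_dist T S"
    using in_X N_minus_commute by (auto simp: op_dist_def map_norm_def intro!: SUP_cong)
  show "op_dist S T = 0 \<longleftrightarrow> S = T" if ST: "S \<in> operators" "T \<in> operators"
  proof
    assume 0: "op_dist S T = 0"
    have "S y = T y" if "y \<in> unit_ball" for y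
      using upper[OF ST that] 0 N_nonneg[OF X_diff[OF in_X[OF ST(1) that] in_X[OF ST(2) that]]]
        N_eq_0_iff[OF X_diff[OF in_X[OF ST(1) that] in_X[OF ST(2) that]]] by simp
    then have "S x = T x" if "x \<in> X" for x
      using operator_scale_sphere ST that by blast
    moreover have "S \<in> extensional X" "T \<in> extensional X"
      using ST by (auto simp: operators_def bounded_linear_maps_def PiE_def)
    ultimately show "S = T" using extensionalityI[of S X T] by simp
  next
    assume "S = T"
    moreover have "(SUP x\<in>unit_ball. (0::real)) = 0"
      using zero_in_unit_ball by (intro cSUP_const) auto
    ultimately show "op_dist S T = 0"
      using N_eq_0_iff[of 0] subspace_0[OF subspace_X]
      by (auto simp: op_dist_def map_norm_def)
  qed
  show "op_dist S U \<le> op_dist S T + op_dist T U"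
    if ST: "S \<in> operators" "T \<in> operators" "U \<in> operators"
  proof -
    have "N (S x - U x) \<le> op_dist S T + op_dist T U" if x: "x \<in> unit_ball" for x
      using N_triangle[OF X_diff[OF in_X[OF ST(1) x] in_X[OF ST(2) x]]
          X_diff[OF in_X[OF ST(2) x] in_X[OF ST(3) x]]]
        upper[OF ST(1,2) x] upper[OF ST(2,3) x] by simp
    then have "map_norm N (\<lambda>x. S x - U x) \<le> op_dist S T + op_dist T U"
      unfolding map_norm_def using zero_in_unit_ball by (intro cSUP_least) auto
    then show ?thesis using ST by (simp add: op_dist_def)
  qed
qed

definition op_topology :: "('v \<Rightarrow> 'v) topology" where
  "op_topology = op.mtopology"

definition compact_operators :: "('v \<Rightarrow> 'v) set" where
  "compact_operators =
    {T \<in> operators. compactin vec.mtopology (vec.mtopology closure_of (T ` unit_ball))}"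

definition duality_pairs :: "('v \<times> ('v \<Rightarrow> 'k)) set" where
  "duality_pairs = {(x, f). x \<in> unit_sphere \<and> f \<in> dual_sphere \<and> f x = 1}"

text \<open>
  For \<open>X = {0}\<close> there are no duality pairs, so the supremum below is a junk value and no operator
  attains it; this degenerate space has to be excluded where these notions are used.
\<close>

definition numerical_radius :: "('v \<Rightarrow> 'v) \<Rightarrow> real" where
  "numerical_radius T = (SUP (x, f)\<in>duality_pairs. norm (f (T x)))"

definition NRA :: "('v \<Rightarrow> 'v) set" where
  "NRA = {T \<in> operators. \<exists>(x, f)\<in>duality_pairs. norm (f (T x)) = numerical_radius T}"

end

locale banach_space_on = normed_space_on +
  assumes complete: "vec.mcomplete"

text \<open>
  The ambient space of all scalar sequences has algebraic dimension continuum, so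
  every real or complex vector space of dimension at most continuum is isomorphic to a
  linear subspace of it.
\<close>

definition seq_scale :: "'k \<Rightarrow> (nat \<Rightarrow> 'k) \<Rightarrow> nat \<Rightarrow> 'k::field" where
  "seq_scale c a = (\<lambda>n. c * a n)"

lemma vector_space_seq_scale: "vector_space seq_scale"
  by unfold_locales (auto simp: seq_scale_def fun_eq_iff algebra_simps)

end

theory Submission
  imports Defs
begin

text \<open>
  The space is an \<open>\<ell>\<^sub>1\<close>-sum \<open>X = Y \<oplus> Z\<close>, where \<open>Z\<close> is a subspace of \<open>c\<^sub>0\<close> and \<open>Y\<close> is a space
  of null sequences with a strictly convex norm, and the operator is \<open>T (y, z) = (K z, 0)\<close> for
  a compact \<open>K : Z \<rightarrow> Y\<close>. Two facts contradict each other when an operator \<open>S\<close> near \<open>T\<close> attains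
  its numerical radius. Write \<open>B : Z \<rightarrow> Y\<close> for the corner of \<open>S\<close> that approximates \<open>K\<close>.

  First, \<open>B\<close> has finite rank. Along an \<open>\<ell>\<^sub>1\<close>-sum the quantity \<open>x\<^sup>* (S x)\<close> is affine between
  the two normalised components of \<open>x\<close>, so an operator that attains its numerical radius and
  is close to \<open>T\<close> attains it at a point \<open>(0, z)\<close>. There the \<open>Y\<close>-part of \<open>x\<^sup>*\<close> is an arbitrary
  functional of norm at most 1, while a null sequence \<open>z\<close> of norm 1 can be moved, without
  leaving the unit ball, by every small \<open>w\<close> that vanishes on a certain finite number of
  initial coordinates. Comparing \<open>z\<close> with \<open>z + w\<close> and \<open>z - w\<close> gives
  \<open>\<parallel>B z + B w\<parallel> + \<parallel>B z - B w\<parallel> \<le> 2 \<parallel>B z\<parallel>\<close>, and strict convexity puts \<open>B w\<close> on the line through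
  \<open>B z\<close> (\<open>corner_on_flat_direction\<close>).

  Secondly, \<open>K\<close> is not a norm limit of finite-rank maps. This is the failure of the
  approximation property, in the matrix form of Enflo's theorem found by Davie: there is an
  infinite matrix \<open>a\<close> with \<open>a\<^sup>2 = 0\<close> and trace 1 whose rows are so small that \<open>\<Sum>i. l i / \<kappa> i\<close>
  converges, where \<open>l i\<close> bounds the \<open>i\<close>-th row and \<open>\<kappa>\<close> is some positive null sequence. Take
  for \<open>Z\<close> the null sequences \<open>z\<close> with \<open>z a = 0\<close>; it contains the rows of \<open>a\<close>, because
  \<open>a\<^sup>2 = 0\<close>. Let \<open>K\<close> multiply by \<open>\<kappa>\<close>. Then \<open>B \<mapsto> \<Sum>i. (B a\<^sub>i)\<^sub>i / \<kappa>\<^sub>i\<close> is a bounded functional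
  with value 1 at \<open>K\<close>. For a rank-one map \<open>\<phi> \<otimes> y\<close> its value is \<open>\<phi>\<close> applied to
  \<open>\<Sum>i. (y\<^sub>i / \<kappa>\<^sub>i) a\<^sub>i\<close>, so it vanishes on all finite-rank maps if \<open>Y\<close> consists of the null
  sequences \<open>y\<close> for which that vector is zero (\<open>trace_finite_rank\<close>).

  The matrix is explicit. Level \<open>n\<close> is an elementary abelian 2-group of order \<open>8 * 4 ^ n\<close>, and
  two disjoint sets of its characters, of sizes \<open>4 ^ n\<close> and \<open>4 ^ (n + 1)\<close>, are singled out.
  The larger set on level \<open>n\<close> is matched with the smaller one on level \<open>n + 1\<close>, and each
  matched pair contributes one rank-one matrix. Orthogonality of characters gives \<open>a\<^sup>2 = 0\<close>,
  and the diagonal telescopes away except on level 0. The entries are small because the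
  character sets are graphs of bilinear forms over the two-element field: apart from complete
  character sums, which vanish, the sums that occur are sums of signs \<open>(- 1) ^ q (x, y)\<close> where
  \<open>q\<close> is, up to linear terms, a bilinear form of almost full rank. They are of the order of
  the square root of the number of terms (\<open>band_sum_le\<close>).
\<close>

section \<open>Null sequences and a strictly convex norm\<close>

definition sup_norm :: "(nat \<Rightarrow> real) \<Rightarrow> real" where
  "sup_norm z = (SUP i. \<bar>z i\<bar>)"

text \<open>
  A weighted \<open>\<ell>\<^sub>2\<close> inner product. The geometric weights make it finite on bounded sequences;
  it is added to the supremum norm only to make the latter strictly convex.
\<close>

definition wip :: "(nat \<Rightarrow> real) \<Rightarrow> (nat \<Rightarrow> real) \<Rightarrow> real" where
  "wip u v = (\<Sum>i. (1 / 2) ^ i * (u i * v i))"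

definition rotund_norm :: "(nat \<Rightarrow> real) \<Rightarrow> real" where
  "rotund_norm y = sup_norm y + sqrt (wip y y)"

definition null_seqs :: "(nat \<Rightarrow> real) set" where
  "null_seqs = {z. z \<longlonglongrightarrow> 0}"

lemma seq_scale_apply [simp]: "seq_scale c z i = c * z i"
  by (simp add: seq_scale_def)

lemma null_zero [simp]: "0 \<in> null_seqs"
  by (simp add: null_seqs_def zero_fun_def)

lemma null_add [simp]: "u \<in> null_seqs \<Longrightarrow> v \<in> null_seqs \<Longrightarrow> u + v \<in> null_seqs"
  using tendsto_add[of u 0 _ v 0] by (simp add: null_seqs_def plus_fun_def)

lemma null_diff [simp]: "u \<in> null_seqs \<Longrightarrow> v \<in> null_seqs \<Longrightarrow> u - v \<in> null_seqs"
  using tendsto_diff[of u 0 _ v 0] by (simp add: null_seqs_def fun_diff_def)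

lemma null_scale [simp]: "u \<in> null_seqs \<Longrightarrow> seq_scale c u \<in> null_seqs"
  using tendsto_mult_left[of u 0 _ c] by (simp add: null_seqs_def seq_scale_def)

lemma abs_le_sup_norm:
  assumes "z \<in> null_seqs"
  shows "\<bar>z i\<bar> \<le> sup_norm z"
proof -
  have "Bseq z" using assms by (auto simp: null_seqs_def intro: convergent_imp_Bseq convergentI)
  then obtain K where "\<And>n. norm (z n) \<le> K" by (auto simp: Bseq_def)
  then have "bdd_above (range (\<lambda>i. \<bar>z i\<bar>))" by (intro bdd_aboveI2) auto
  then show ?thesis unfolding sup_norm_def by (rule cSUP_upper[rotated]) simp
qed

lemma sup_norm_least: "(\<And>i. \<bar>z i\<bar> \<le> B) \<Longrightarrow> sup_norm z \<le> B"
  unfolding sup_norm_def by (rule cSUP_least) auto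

lemma sup_norm_nonneg: "z \<in> null_seqs \<Longrightarrow> 0 \<le> sup_norm z"
  using abs_le_sup_norm[of z 0] by linarith

lemma sup_norm_zero [simp]: "sup_norm 0 = 0"
  by (simp add: sup_norm_def)

lemma sup_norm_eq_0_iff:
  assumes "z \<in> null_seqs"
  shows "sup_norm z = 0 \<longleftrightarrow> z = 0"
proof
  assume "sup_norm z = 0"
  then show "z = 0" using abs_le_sup_norm[OF assms] by (auto simp: fun_eq_iff)
qed simp

lemma sup_norm_triangle:
  assumes "u \<in> null_seqs" "v \<in> null_seqs"
  shows "sup_norm (u + v) \<le> sup_norm u + sup_norm v"
proof (rule sup_norm_least)
  fix i
  show "\<bar>(u + v) i\<bar> \<le> sup_norm u + sup_norm v"
    using abs_le_sup_norm[OF assms(1), of i] abs_le_sup_norm[OF assms(2), of i] by auto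
qed

lemma sup_norm_scale:
  assumes "u \<in> null_seqs"
  shows "sup_norm (seq_scale c u) = \<bar>c\<bar> * sup_norm u"
proof (cases "c = 0")
  case True
  then have "seq_scale c u = 0" by (simp add: fun_eq_iff)
  then show ?thesis using True by simp
next
  case False
  show ?thesis
  proof (rule antisym)
    show "sup_norm (seq_scale c u) \<le> \<bar>c\<bar> * sup_norm u"
      by (rule sup_norm_least) (simp add: abs_mult mult_left_mono abs_le_sup_norm assms)
    have "sup_norm u \<le> sup_norm (seq_scale c u) / \<bar>c\<bar>"
    proof (rule sup_norm_least)
      fix i
      show "\<bar>u i\<bar> \<le> sup_norm (seq_scale c u) / \<bar>c\<bar>"
        using abs_le_sup_norm[of "seq_scale c u" i] assms False
        by (simp add: abs_mult field_simps)
    qed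
    then show "\<bar>c\<bar> * sup_norm u \<le> sup_norm (seq_scale c u)"
      using False by (simp add: field_simps)
  qed
qed

lemma sup_norm_attained:
  assumes "z \<in> null_seqs"
  obtains k where "\<bar>z k\<bar> = sup_norm z"
proof (rule ccontr)
  assume "\<not> thesis"
  with that have lt: "\<bar>z k\<bar> < sup_norm z" for k
    using abs_le_sup_norm[OF assms, of k] by (metis order_le_less)
  then have pos: "0 < sup_norm z" by (metis abs_ge_zero order_le_less_trans)
  then obtain n where n: "\<And>i. i \<ge> n \<Longrightarrow> \<bar>z i\<bar> < sup_norm z / 2"
    using assms unfolding null_seqs_def mem_Collect_eq LIMSEQ_iff
    by (metis diff_zero half_gt_zero real_norm_def)
  define B where "B = Max (insert (sup_norm z / 2) ((\<lambda>i. \<bar>z i\<bar>) ` {..<n}))"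
  have "\<bar>z i\<bar> \<le> B" for i
  proof (cases "i < n")
    case False
    then have "\<bar>z i\<bar> \<le> sup_norm z / 2" using n[of i] by simp
    also have "\<dots> \<le> B" unfolding B_def by (rule Max_ge) auto
    finally show ?thesis .
  qed (simp add: B_def)
  then have "sup_norm z \<le> B" by (rule sup_norm_least)
  moreover have "B < sup_norm z" using lt pos by (simp add: B_def)
  ultimately show False by simp
qed

lemma wip_summable:
  assumes "u \<in> null_seqs" "v \<in> null_seqs"
  shows "summable (\<lambda>i. (1 / 2) ^ i * (u i * v i))"
proof (rule summable_comparison_test')
  show "summable (\<lambda>i. (1 / 2) ^ i * (sup_norm u * sup_norm v))"
    by (intro summable_mult2 summable_geometric) simp
  show "norm ((1 / 2) ^ i * (u i * v i)) \<le> (1 / 2) ^ i * (sup_norm u * sup_norm v)" for i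
    using assms by (simp add: abs_mult mult_mono abs_le_sup_norm sup_norm_nonneg divide_right_mono)
qed

lemma wip_commute: "wip u v = wip v u"
  by (simp add: wip_def mult.commute)

lemma wip_add_right:
  assumes "u \<in> null_seqs" "v \<in> null_seqs" "w \<in> null_seqs"
  shows "wip u (v + w) = wip u v + wip u w"
  using suminf_add[OF wip_summable[OF assms(1,2)] wip_summable[OF assms(1,3)]]
  by (simp add: wip_def distrib_left)

lemma wip_scale_right:
  assumes "u \<in> null_seqs" "v \<in> null_seqs"
  shows "wip u (seq_scale c v) = c * wip u v"
  using suminf_mult[OF wip_summable[OF assms], of c] by (simp add: wip_def mult.left_commute)

lemma wip_diff_right:
  assumes "u \<in> null_seqs" "v \<in> null_seqs" "w \<in> null_seqs"
  shows "wip u (v - w) = wip u v - wip u w"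
  using suminf_diff[OF wip_summable[OF assms(1,2)] wip_summable[OF assms(1,3)]]
  by (simp add: wip_def right_diff_distrib)

lemma wip_left:
  assumes "u \<in> null_seqs" "v \<in> null_seqs" "w \<in> null_seqs"
  shows "wip (u + v) w = wip u w + wip v w" "wip (u - v) w = wip u w - wip v w"
    "wip (seq_scale c u) w = c * wip u w"
  using assms by (simp_all add: wip_commute[of _ w] wip_add_right wip_diff_right wip_scale_right)

lemmas wip_bilinear = wip_left wip_add_right wip_diff_right wip_scale_right

lemma wip_nonneg: "u \<in> null_seqs \<Longrightarrow> 0 \<le> wip u u"
  unfolding wip_def by (intro suminf_nonneg wip_summable) auto

lemma wip_eq_0_iff:
  assumes "u \<in> null_seqs"
  shows "wip u u = 0 \<longleftrightarrow> u = 0"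
  unfolding wip_def using assms
  by (subst suminf_eq_zero_iff) (auto intro: wip_summable simp: fun_eq_iff)

lemma wip_zero [simp]: "wip 0 u = 0" "wip u 0 = 0"
  by (simp_all add: wip_def)

lemma wip_sqrt_mult: "u \<in> null_seqs \<Longrightarrow> sqrt (wip u u) * sqrt (wip u u) = wip u u"
  using wip_nonneg by simp

lemma wip_combination:
  assumes "u \<in> null_seqs" "v \<in> null_seqs" and "\<alpha> * \<alpha> = wip u u" "\<beta> * \<beta> = wip v v"
  shows "wip (seq_scale \<beta> u - seq_scale \<alpha> v) (seq_scale \<beta> u - seq_scale \<alpha> v)
    = 2 * (\<alpha> * \<beta>) * (\<alpha> * \<beta> - wip u v)"
  using assms(1,2) by (simp add: wip_bilinear wip_commute[of v u] flip: assms(3,4))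
    (simp add: algebra_simps)

lemma wip_Cauchy_Schwarz:
  assumes "u \<in> null_seqs" "v \<in> null_seqs"
  shows "wip u v \<le> sqrt (wip u u) * sqrt (wip v v)"
proof (cases "u = 0 \<or> v = 0")
  case False
  let ?a = "sqrt (wip u u)" and ?b = "sqrt (wip v v)"
  have "0 < ?a * ?b"
    using False wip_eq_0_iff wip_nonneg assms
    by (metis less_eq_real_def mult_pos_pos real_sqrt_gt_0_iff)
  moreover have "0 \<le> 2 * (?a * ?b) * (?a * ?b - wip u v)"
    using assms wip_nonneg[of "seq_scale ?b u - seq_scale ?a v"]
    by (subst wip_combination[symmetric]) (auto simp: wip_nonneg)
  ultimately show ?thesis by (simp add: zero_le_mult_iff)
qed auto

lemma wip_Cauchy_Schwarz_abs:
  assumes "u \<in> null_seqs" "v \<in> null_seqs"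
  shows "\<bar>wip u v\<bar> \<le> sqrt (wip u u) * sqrt (wip v v)"
  using wip_Cauchy_Schwarz[OF assms] wip_Cauchy_Schwarz[of "seq_scale (-1) u" v] assms
  by (simp add: wip_bilinear)

lemma wip_sqrt_triangle:
  assumes "u \<in> null_seqs" "v \<in> null_seqs"
  shows "sqrt (wip (u + v) (u + v)) \<le> sqrt (wip u u) + sqrt (wip v v)"
proof (rule real_le_lsqrt)
  show "wip (u + v) (u + v) \<le> (sqrt (wip u u) + sqrt (wip v v))\<^sup>2"
    using wip_Cauchy_Schwarz[OF assms] assms
    by (simp add: wip_bilinear wip_commute[of v u] power2_eq_square algebra_simps wip_nonneg)
qed (use assms in \<open>simp add: wip_nonneg\<close>)

lemma wip_sqrt_scale:
  assumes "u \<in> null_seqs"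
  shows "sqrt (wip (seq_scale c u) (seq_scale c u)) = \<bar>c\<bar> * sqrt (wip u u)"
  using assms by (simp add: wip_bilinear real_sqrt_mult flip: mult.assoc)

text \<open>
  With \<open>p = u + v\<close> and \<open>q = u - v\<close> the hypothesis reads \<open>\<bar>p\<bar> + \<bar>q\<bar> \<le> \<bar>p + q\<bar>\<close>. Squaring turns
  it into equality in the Cauchy-Schwarz inequality for \<open>p\<close> and \<open>q\<close>, so these are nonnegative
  multiples of a common vector, and \<open>v = (p - q) / 2\<close> is a multiple of \<open>u = (p + q) / 2\<close>.
\<close>

lemma wip_strictly_convex:
  assumes u: "u \<in> null_seqs" and v: "v \<in> null_seqs"
    and le: "sqrt (wip (u + v) (u + v)) + sqrt (wip (u - v) (u - v)) \<le> 2 * sqrt (wip u u)"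
  shows "\<exists>c. v = seq_scale c u"
proof -
  let ?p = "u + v" and ?q = "u - v"
  define \<alpha> where "\<alpha> = sqrt (wip ?p ?p)"
  define \<beta> where "\<beta> = sqrt (wip ?q ?q)"
  have nn: "0 \<le> \<alpha>" "0 \<le> \<beta>" using u v by (simp_all add: \<alpha>_def \<beta>_def wip_nonneg)
  have sq: "\<alpha> * \<alpha> = wip ?p ?p" "\<beta> * \<beta> = wip ?q ?q"
    using u v unfolding \<alpha>_def \<beta>_def by (simp_all only: wip_sqrt_mult null_add null_diff)
  have "(\<alpha> + \<beta>) * (\<alpha> + \<beta>) \<le> (2 * sqrt (wip u u)) * (2 * sqrt (wip u u))"
    using le nn wip_nonneg[OF u] by (intro mult_mono) (auto simp: \<alpha>_def \<beta>_def)
  then have "\<alpha> * \<alpha> + \<beta> * \<beta> + 2 * (\<alpha> * \<beta>) \<le> 4 * wip u u"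
    using wip_sqrt_mult[OF u] by (simp add: algebra_simps)
  then have "\<alpha> * \<beta> \<le> wip ?p ?q"
    unfolding sq using u v by (simp add: wip_bilinear wip_commute[of v u] algebra_simps)
  then have "2 * (\<alpha> * \<beta>) * (\<alpha> * \<beta> - wip ?p ?q) \<le> 0"
    using nn by (intro mult_nonneg_nonpos) auto
  moreover have comb: "wip (seq_scale \<beta> ?p - seq_scale \<alpha> ?q) (seq_scale \<beta> ?p - seq_scale \<alpha> ?q)
      = 2 * (\<alpha> * \<beta>) * (\<alpha> * \<beta> - wip ?p ?q)"
    using u v sq by (intro wip_combination) auto
  moreover have null: "seq_scale \<beta> ?p - seq_scale \<alpha> ?q \<in> null_seqs" using u v by simp
  ultimately have "seq_scale \<beta> ?p - seq_scale \<alpha> ?q = 0"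
    using wip_nonneg[OF null] wip_eq_0_iff[OF null] by linarith
  then have eq: "\<beta> * (u i + v i) = \<alpha> * (u i - v i)" for i
    by (simp add: fun_eq_iff)
  show ?thesis
  proof (cases "\<alpha> + \<beta> = 0")
    case True
    then have "\<alpha> = 0" "\<beta> = 0" using nn by auto
    then have "?p = 0" "?q = 0" using sq wip_eq_0_iff u v by auto
    then have "v = seq_scale 0 u" by (auto simp: fun_eq_iff)
    then show ?thesis ..
  next
    case False
    then have "v = seq_scale ((\<alpha> - \<beta>) / (\<alpha> + \<beta>)) u"
      using eq by (auto simp: fun_eq_iff field_simps)
    then show ?thesis ..
  qed
qed

lemma wip_sqrt_le:
  assumes "u \<in> null_seqs"
  shows "sqrt (wip u u) \<le> 2 * sup_norm u"
proof (rule real_le_lsqrt)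
  have "wip u u \<le> (\<Sum>i. (1 / 2) ^ i * (sup_norm u * sup_norm u))"
    unfolding wip_def
  proof (rule suminf_le[OF _ wip_summable[OF assms assms]])
    show "summable (\<lambda>i. (1 / 2) ^ i * (sup_norm u * sup_norm u))"
      by (intro summable_mult2 summable_geometric) simp
    show "(1 / 2) ^ i * (u i * u i) \<le> (1 / 2) ^ i * (sup_norm u * sup_norm u)" for i
      using abs_le_sup_norm[OF assms, of i]
      by (intro mult_left_mono) (auto simp: abs_le_square_iff[symmetric] simp flip: power2_eq_square)
  qed
  also have "\<dots> = 2 * (sup_norm u * sup_norm u)"
    by (subst suminf_mult2[symmetric]) (auto simp: suminf_geometric)
  also have "\<dots> \<le> (2 * sup_norm u)\<^sup>2" by (simp add: power2_eq_square)
  finally show "wip u u \<le> (2 * sup_norm u)\<^sup>2" .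
qed (use assms in \<open>simp add: sup_norm_nonneg\<close>)

lemma rotund_norm_bounds:
  assumes "u \<in> null_seqs"
  shows "sup_norm u \<le> rotund_norm u" "rotund_norm u \<le> 3 * sup_norm u"
  using wip_sqrt_le[OF assms] wip_nonneg[OF assms] by (auto simp: rotund_norm_def)

lemma rotund_norm_zero [simp]: "rotund_norm 0 = 0"
  by (simp add: rotund_norm_def)

lemma rotund_norm_nonneg: "u \<in> null_seqs \<Longrightarrow> 0 \<le> rotund_norm u"
  using rotund_norm_bounds(1) sup_norm_nonneg by force

lemma rotund_norm_eq_0_iff: "u \<in> null_seqs \<Longrightarrow> rotund_norm u = 0 \<longleftrightarrow> u = 0"
  using rotund_norm_bounds(1) sup_norm_nonneg sup_norm_eq_0_iff by fastforce

lemma rotund_norm_triangle: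
  "u \<in> null_seqs \<Longrightarrow> v \<in> null_seqs \<Longrightarrow> rotund_norm (u + v) \<le> rotund_norm u + rotund_norm v"
  using sup_norm_triangle wip_sqrt_triangle by (fastforce simp: rotund_norm_def)

lemma rotund_norm_scale: "u \<in> null_seqs \<Longrightarrow> rotund_norm (seq_scale c u) = \<bar>c\<bar> * rotund_norm u"
  by (simp add: rotund_norm_def sup_norm_scale wip_sqrt_scale algebra_simps)

text \<open>
  The supremum norm satisfies the opposite inequality, so the hypothesis is inherited by the
  inner-product part.
\<close>

lemma rotund_norm_strictly_convex:
  assumes u: "u \<in> null_seqs" and v: "v \<in> null_seqs"
    and le: "rotund_norm (u + v) + rotund_norm (u - v) \<le> 2 * rotund_norm u"
  shows "\<exists>c. v = seq_scale c u"
proof (rule wip_strictly_convex[OF u v])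
  have "seq_scale 2 u = (u + v) + (u - v)" by (simp add: fun_eq_iff)
  then have "2 * sup_norm u \<le> sup_norm (u + v) + sup_norm (u - v)"
    using sup_norm_triangle[of "u + v" "u - v"] sup_norm_scale[OF u, of 2] u v by simp
  then show "sqrt (wip (u + v) (u + v)) + sqrt (wip (u - v) (u - v)) \<le> 2 * sqrt (wip u u)"
    using le by (simp add: rotund_norm_def)
qed

text \<open>
  A norming functional can be written down, without the Hahn-Banach theorem: a null sequence
  attains its supremum at some coordinate \<open>k\<close>, and the signed coordinate functional at \<open>k\<close>
  plus the normalised inner product with \<open>u\<close> norms both parts of the norm at once. For \<open>u = 0\<close>
  both terms are zero.
\<close>

lemma rotund_norm_norming:
  assumes u: "u \<in> null_seqs"
  obtains J :: "(nat \<Rightarrow> real) \<Rightarrow> real" where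
    "\<And>v w. v \<in> null_seqs \<Longrightarrow> w \<in> null_seqs \<Longrightarrow> J (v + w) = J v + J w"
    "\<And>c v. v \<in> null_seqs \<Longrightarrow> J (seq_scale c v) = c * J v"
    "\<And>v. v \<in> null_seqs \<Longrightarrow> \<bar>J v\<bar> \<le> rotund_norm v"
    "J u = rotund_norm u"
proof -
  obtain k where k: "\<bar>u k\<bar> = sup_norm u" using sup_norm_attained[OF u] .
  let ?J = "\<lambda>v. sgn (u k) * v k + wip u v / sqrt (wip u u)"
  show thesis
  proof (rule that[of ?J])
    show "?J (v + w) = ?J v + ?J w" if "v \<in> null_seqs" "w \<in> null_seqs" for v w
      using that u by (simp add: wip_bilinear algebra_simps add_divide_distrib)
    show "?J (seq_scale c v) = c * ?J v" if "v \<in> null_seqs" for c v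
      using that u by (simp add: wip_bilinear algebra_simps)
    show "\<bar>?J v\<bar> \<le> rotund_norm v" if v: "v \<in> null_seqs" for v
    proof -
      have "\<bar>sgn (u k) * v k\<bar> \<le> sup_norm v"
        using abs_le_sup_norm[OF v, of k] sup_norm_nonneg[OF v] by (simp add: abs_mult abs_sgn_eq)
      moreover have "\<bar>wip u v / sqrt (wip u u)\<bar> \<le> sqrt (wip v v)"
      proof (cases "u = 0")
        case False
        then have "0 < sqrt (wip u u)"
          using wip_nonneg[OF u] wip_eq_0_iff[OF u] by simp
        then show ?thesis
          using wip_Cauchy_Schwarz_abs[OF u v] wip_nonneg[OF u]
          by (simp add: abs_divide divide_le_eq mult.commute)
      qed (use wip_nonneg[OF v] in simp)
      ultimately show ?thesis unfolding rotund_norm_def by linarith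
    qed
    have "wip u u / sqrt (wip u u) = sqrt (wip u u)"
      using wip_nonneg[OF u] by (simp add: real_div_sqrt)
    then show "?J u = rotund_norm u"
      using k by (simp add: rotund_norm_def) (metis mult.commute mult_sgn_abs abs_mult_sgn linordered_idom_class.abs_sgn)
  qed
qed

section \<open>The Banach space\<close>

text \<open>
  The null sequences \<open>z\<close> whose product with the matrix \<open>b\<close>, taken as row vector times matrix,
  is zero.
\<close>

definition null_kernel :: "(nat \<Rightarrow> nat \<Rightarrow> real) \<Rightarrow> (nat \<Rightarrow> real) set" where
  "null_kernel b = {z \<in> null_seqs. \<forall>k. (\<lambda>i. z i * b i k) sums 0}"

lemma null_kernel_null: "z \<in> null_kernel b \<Longrightarrow> z \<in> null_seqs"
  by (simp add: null_kernel_def)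

lemma null_kernel_zero: "0 \<in> null_kernel b"
  by (simp add: null_kernel_def)

lemma null_kernel_add:
  assumes "u \<in> null_kernel b" "v \<in> null_kernel b"
  shows "u + v \<in> null_kernel b"
proof -
  have "(\<lambda>i. u i * b i k + v i * b i k) sums (0 + 0)" for k
    using assms by (intro sums_add) (auto simp: null_kernel_def)
  then show ?thesis using assms by (simp add: null_kernel_def distrib_right)
qed

lemma null_kernel_scale:
  assumes "u \<in> null_kernel b"
  shows "seq_scale c u \<in> null_kernel b"
proof -
  have "(\<lambda>i. c * (u i * b i k)) sums (c * 0)" for k
    using assms by (intro sums_mult) (auto simp: null_kernel_def)
  then show ?thesis using assms by (simp add: null_kernel_def mult.assoc)
qed

lemma null_kernel_diff:
  assumes "u \<in> null_kernel b" "v \<in> null_kernel b"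
  shows "u - v \<in> null_kernel b"
proof -
  have "u - v = u + seq_scale (-1) v" by (simp add: fun_eq_iff)
  then show ?thesis using assms null_kernel_add null_kernel_scale by metis
qed

text \<open>
  If the rows of \<open>b\<close> are summable in supremum norm, then \<open>z \<mapsto> z b\<close> is continuous for the
  supremum norm, so its kernel is closed.
\<close>

lemma null_kernel_uniform_limit:
  assumes b: "\<And>i k. \<bar>b i k\<bar> \<le> m i" and m: "summable m"
    and lim: "\<And>\<epsilon>. 0 < \<epsilon> \<Longrightarrow> \<exists>u\<in>null_kernel b. \<forall>i. \<bar>u i - z i\<bar> \<le> \<epsilon>"
  shows "z \<in> null_kernel b"
proof -
  have "z \<longlonglongrightarrow> 0"
  proof (rule LIMSEQ_I)
    fix r :: real assume "0 < r"
    then obtain u where u: "u \<in> null_kernel b" "\<And>i. \<bar>u i - z i\<bar> \<le> r / 2"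
      using lim[of "r / 2"] by auto
    then have "u \<longlonglongrightarrow> 0" by (simp add: null_kernel_def null_seqs_def)
    then obtain n where n: "\<And>i. i \<ge> n \<Longrightarrow> \<bar>u i\<bar> < r / 2"
      using LIMSEQ_D[of u 0 "r / 2"] \<open>0 < r\<close> by auto
    have "norm (z i - 0) < r" if "i \<ge> n" for i
      using u(2)[of i] n[OF that] by (simp add: abs_if split: if_splits)
    then have "\<forall>i\<ge>n. norm (z i - 0) < r" by blast
    then show "\<exists>n. \<forall>i\<ge>n. norm (z i - 0) < r" ..
  qed
  then have z: "z \<in> null_seqs" by (simp add: null_seqs_def)
  have m0: "0 \<le> m i" for i using b[of i 0] by linarith
  have summ: "summable (\<lambda>i. z i * b i k)" for k
  proof (rule summable_comparison_test')
    show "summable (\<lambda>i. sup_norm z * m i)" using m by (rule summable_mult)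
    show "norm (z i * b i k) \<le> sup_norm z * m i" for i
      using b abs_le_sup_norm[OF z] by (simp add: abs_mult mult_mono sup_norm_nonneg[OF z])
  qed
  have "(\<Sum>i. z i * b i k) = 0" for k
  proof -
    have le: "\<bar>\<Sum>i. z i * b i k\<bar> \<le> \<epsilon> * suminf m" if \<epsilon>: "0 < \<epsilon>" for \<epsilon>
    proof -
      obtain u where u: "u \<in> null_kernel b" "\<And>i. \<bar>u i - z i\<bar> \<le> \<epsilon>"
        using lim[OF \<epsilon>] by auto
      then have "(\<lambda>i. u i * b i k) sums 0" by (simp add: null_kernel_def)
      then have "(\<lambda>i. z i * b i k - u i * b i k) sums ((\<Sum>i. z i * b i k) - 0)"
        using sums_diff[OF summable_sums[OF summ]] by blast
      then have eq: "(\<lambda>i. (z i - u i) * b i k) sums (\<Sum>i. z i * b i k)"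
        by (simp add: left_diff_distrib)
      have "norm ((z i - u i) * b i k) \<le> \<epsilon> * m i" for i
        using b[of i k] u(2)[of i] \<epsilon> m0 by (simp add: abs_mult mult_mono abs_minus_commute)
      then have "norm (\<Sum>i. (z i - u i) * b i k) \<le> (\<Sum>i. \<epsilon> * m i)"
        by (intro norm_suminf_le summable_mult m)
      then show ?thesis using eq m by (simp add: sums_iff suminf_mult)
    qed
    show ?thesis
    proof (rule ccontr)
      assume "(\<Sum>i. z i * b i k) \<noteq> 0"
      then have pos: "0 < \<bar>\<Sum>i. z i * b i k\<bar>" by simp
      have "0 \<le> suminf m" using m m0 by (intro suminf_nonneg)
      then have "\<bar>\<Sum>i. z i * b i k\<bar> / (2 * (suminf m + 1)) * suminf m < \<bar>\<Sum>i. z i * b i k\<bar>"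
        using pos by (simp add: field_simps add_nonneg_pos)
      then show False
        using le[of "\<bar>\<Sum>i. z i * b i k\<bar> / (2 * (suminf m + 1))"] pos \<open>0 \<le> suminf m\<close> by simp
    qed
  qed
  then show ?thesis using z summ by (simp add: null_kernel_def sums_iff)
qed

text \<open>
  The direct sum of \<open>Y\<close> and \<open>Z\<close> has to consist of real sequences, so a pair is stored in one
  sequence, at the even and at the odd places.
\<close>

definition evens :: "(nat \<Rightarrow> real) \<Rightarrow> nat \<Rightarrow> real" where
  "evens x = (\<lambda>i. x (2 * i))"

definition odds :: "(nat \<Rightarrow> real) \<Rightarrow> nat \<Rightarrow> real" where
  "odds x = (\<lambda>i. x (Suc (2 * i)))"

definition interleave :: "(nat \<Rightarrow> real) \<Rightarrow> (nat \<Rightarrow> real) \<Rightarrow> nat \<Rightarrow> real" where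
  "interleave y z = (\<lambda>n. if even n then y (n div 2) else z (n div 2))"

lemma evens_interleave [simp]: "evens (interleave y z) = y"
  and odds_interleave [simp]: "odds (interleave y z) = z"
  by (simp_all add: evens_def odds_def interleave_def)

lemma interleave_evens_odds: "interleave (evens x) (odds x) = x"
proof
  fix n show "interleave (evens x) (odds x) n = x n"
    by (cases "even n") (simp_all add: evens_def odds_def interleave_def)
qed

lemma interleave_eqI: "evens x = evens x' \<Longrightarrow> odds x = odds x' \<Longrightarrow> x = x'"
  by (metis interleave_evens_odds)

lemma evens_odds_simps [simp]:
  "evens (x + x') = evens x + evens x'" "odds (x + x') = odds x + odds x'"
  "evens (x - x') = evens x - evens x'" "odds (x - x') = odds x - odds x'"
  "evens (seq_scale c x) = seq_scale c (evens x)" "odds (seq_scale c x) = seq_scale c (odds x)"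
  "evens 0 = 0" "odds 0 = 0"
  by (simp_all add: evens_def odds_def fun_eq_iff)

text \<open>
  The rows of \<open>a\<close> have supremum norms at most \<open>l\<close>, and they stay summable after division by
  the weights \<open>\<kappa>\<close>; the compact operator is multiplication by \<open>\<kappa>\<close>.
\<close>

locale square_zero_matrix =
  fixes a :: "nat \<Rightarrow> nat \<Rightarrow> real" and \<kappa> l :: "nat \<Rightarrow> real"
  assumes entry_le: "\<bar>a i j\<bar> \<le> l i"
    and row_null: "a i \<longlonglongrightarrow> 0"
    and weight_pos: "0 < \<kappa> i" and weight_le_1: "\<kappa> i \<le> 1" and weight_null: "\<kappa> \<longlonglongrightarrow> 0"
    and summable_ratio: "summable (\<lambda>i. l i / \<kappa> i)"
    and square_zero: "(\<lambda>j. a i j * a j k) sums 0"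
    and trace_one: "(\<lambda>i. a i i) sums 1"
begin

text \<open>
  Because \<open>a\<close> has square zero, \<open>Z\<close> contains the rows of \<open>a\<close>. The condition defining \<open>Y\<close> makes
  multiplication by \<open>\<kappa>\<close> map \<open>Z\<close> into \<open>Y\<close>, and it says that \<open>\<Sum>i. (y\<^sub>i / \<kappa>\<^sub>i) a\<^sub>i = 0\<close>, which is
  what makes the trace functional vanish on rank-one maps into \<open>Y\<close>.
\<close>

definition Z :: "(nat \<Rightarrow> real) set" where
  "Z = null_kernel a"

definition Y :: "(nat \<Rightarrow> real) set" where
  "Y = null_kernel (\<lambda>i k. a i k / \<kappa> i)"

definition X :: "(nat \<Rightarrow> real) set" where
  "X = {x. evens x \<in> Y \<and> odds x \<in> Z}"

definition N :: "(nat \<Rightarrow> real) \<Rightarrow> real" where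
  "N x = rotund_norm (evens x) + sup_norm (odds x)"

lemmas Z_closed = null_kernel_zero[of a, folded Z_def] null_kernel_add[of _ a, folded Z_def]
  null_kernel_scale[of _ a, folded Z_def] null_kernel_diff[of _ a, folded Z_def]

lemmas Y_closed = null_kernel_zero[of "\<lambda>i k. a i k / \<kappa> i", folded Y_def]
  null_kernel_add[of _ "\<lambda>i k. a i k / \<kappa> i", folded Y_def]
  null_kernel_scale[of _ "\<lambda>i k. a i k / \<kappa> i", folded Y_def]
  null_kernel_diff[of _ "\<lambda>i k. a i k / \<kappa> i", folded Y_def]

lemma Z_null: "z \<in> Z \<Longrightarrow> z \<in> null_seqs"
  and Y_null: "y \<in> Y \<Longrightarrow> y \<in> null_seqs"
  by (simp_all add: Z_def Y_def null_kernel_null)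

lemma zero_in [simp]: "0 \<in> Y" "0 \<in> Z"
  by (rule Y_closed, rule Z_closed)

lemma X_iff: "x \<in> X \<longleftrightarrow> evens x \<in> Y \<and> odds x \<in> Z"
  by (simp add: X_def)

lemma interleave_in_X [simp]: "interleave y z \<in> X \<longleftrightarrow> y \<in> Y \<and> z \<in> Z"
  by (simp add: X_iff)

lemma N_interleave [simp]: "N (interleave y z) = rotund_norm y + sup_norm z"
  by (simp add: N_def)

lemma l_nonneg: "0 \<le> l i"
  using entry_le[of i 0] by linarith

lemma l_le_ratio: "l i \<le> l i / \<kappa> i"
  using l_nonneg[of i] weight_pos[of i] weight_le_1[of i] mult_left_mono[of "\<kappa> i" 1 "l i"]
  by (simp add: le_divide_eq)

lemma summable_l: "summable l"
  using l_le_ratio l_nonneg by (intro summable_comparison_test'[OF summable_ratio]) auto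

lemma abs_le_N:
  assumes "x \<in> X"
  shows "\<bar>evens x i\<bar> \<le> N x" "\<bar>odds x i\<bar> \<le> N x"
proof -
  have e: "evens x \<in> null_seqs" and o: "odds x \<in> null_seqs"
    using assms Y_null Z_null by (auto simp: X_iff)
  show "\<bar>evens x i\<bar> \<le> N x" "\<bar>odds x i\<bar> \<le> N x"
    using abs_le_sup_norm[OF e, of i] abs_le_sup_norm[OF o, of i] rotund_norm_bounds(1)[OF e]
      sup_norm_nonneg[OF o] rotund_norm_nonneg[OF e]
    unfolding N_def by linarith+
qed

text \<open>
  Together with \<open>abs_le_N\<close> this shows that \<open>N\<close> is equivalent to the supremum norm.
\<close>

lemma N_le:
  assumes "x \<in> X" "\<And>i. \<bar>evens x i\<bar> \<le> B" "\<And>i. \<bar>odds x i\<bar> \<le> B"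
  shows "N x \<le> 4 * B"
  using assms rotund_norm_bounds(2)[OF Y_null, of "evens x"] sup_norm_least[of "evens x" B]
    sup_norm_least[of "odds x" B]
  by (auto simp: N_def X_iff)

lemma normed_space_X: "normed_space_on seq_scale X N"
proof -
  interpret vector_space "seq_scale :: real \<Rightarrow> (nat \<Rightarrow> real) \<Rightarrow> nat \<Rightarrow> real"
    by (rule vector_space_seq_scale)
  show ?thesis
  proof unfold_locales
    show "subspace X"
      by (auto simp: subspace_def X_iff Z_closed Y_closed)
    fix x y :: "nat \<Rightarrow> real" and c :: real
    assume x: "x \<in> X"
    then have nx: "evens x \<in> null_seqs" "odds x \<in> null_seqs" using Y_null Z_null by (auto simp: X_iff)
    show "0 \<le> N x" using nx by (simp add: N_def rotund_norm_nonneg sup_norm_nonneg)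
    show "N x = 0 \<longleftrightarrow> x = 0"
    proof
      assume "N x = 0"
      then have "rotund_norm (evens x) = 0" "sup_norm (odds x) = 0"
        using rotund_norm_nonneg[OF nx(1)] sup_norm_nonneg[OF nx(2)] by (auto simp: N_def)
      then have "evens x = 0" "odds x = 0"
        using nx rotund_norm_eq_0_iff sup_norm_eq_0_iff by blast+
      then show "x = 0" using interleave_eqI[of x 0] by simp
    qed (simp add: N_def)
    show "N (seq_scale c x) = norm c * N x"
      using nx by (simp add: N_def rotund_norm_scale sup_norm_scale distrib_left)
    assume "y \<in> X"
    then have "evens y \<in> null_seqs" "odds y \<in> null_seqs" using Y_null Z_null by (auto simp: X_iff)
    then show "N (x + y) \<le> N x + N y"
      using rotund_norm_triangle[of "evens x" "evens y"] sup_norm_triangle[of "odds x" "odds y"] nx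
      by (simp add: N_def)
  qed
qed

sublocale normed_space_on seq_scale X N
  by (rule normed_space_X)

lemma mcomplete_X: "vec.mcomplete"
  unfolding vec.mcomplete_def
proof (intro allI impI)
  fix \<sigma> assume cauchy: "vec.MCauchy \<sigma>"
  then have in_X: "\<sigma> n \<in> X" for n by (auto simp: vec.MCauchy_def)
  have cauchyD: "\<exists>M. \<forall>n\<ge>M. \<forall>n'\<ge>M. N (\<sigma> n - \<sigma> n') < \<epsilon>" if \<epsilon>: "0 < \<epsilon>" for \<epsilon>
  proof -
    obtain M where "\<forall>n n'. M \<le> n \<longrightarrow> M \<le> n' \<longrightarrow> vec_dist (\<sigma> n) (\<sigma> n') < \<epsilon>"
      using cauchy \<epsilon> unfolding vec.MCauchy_def by blast
    then have "\<forall>n\<ge>M. \<forall>n'\<ge>M. N (\<sigma> n - \<sigma> n') < \<epsilon>" using in_X by (simp add: vec_dist_def)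
    then show ?thesis ..
  qed
  have coord: "\<bar>\<sigma> n i - \<sigma> n' i\<bar> \<le> N (\<sigma> n - \<sigma> n')" for n n' i
  proof (cases "even i")
    case True
    then show ?thesis using abs_le_N(1)[OF X_diff[OF in_X in_X], of n n' "i div 2"]
      by (simp add: evens_def)
  next
    case False
    then show ?thesis using abs_le_N(2)[OF X_diff[OF in_X in_X], of n n' "i div 2"]
      by (simp add: odds_def)
  qed
  have "\<exists>L. (\<lambda>n. \<sigma> n i) \<longlonglongrightarrow> L" for i
  proof -
    have "Cauchy (\<lambda>n. \<sigma> n i)"
    proof (rule metric_CauchyI)
      fix \<epsilon> :: real assume "0 < \<epsilon>"
      then obtain M where "\<forall>n\<ge>M. \<forall>n'\<ge>M. N (\<sigma> n - \<sigma> n') < \<epsilon>" using cauchyD by blast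
      then show "\<exists>M. \<forall>m\<ge>M. \<forall>n\<ge>M. dist (\<sigma> m i) (\<sigma> n i) < \<epsilon>"
        using coord by (metis dist_real_def order_le_less_trans)
    qed
    then show ?thesis by (simp add: Cauchy_convergent_iff convergent_def)
  qed
  then obtain x where x: "\<And>i. (\<lambda>n. \<sigma> n i) \<longlonglongrightarrow> x i" by metis
  have unif: "\<exists>M. \<forall>n\<ge>M. \<forall>i. \<bar>\<sigma> n i - x i\<bar> \<le> \<epsilon>" if \<epsilon>: "0 < \<epsilon>" for \<epsilon>
  proof -
    obtain M where M: "\<forall>n\<ge>M. \<forall>n'\<ge>M. N (\<sigma> n - \<sigma> n') < \<epsilon>" using cauchyD[OF \<epsilon>] by blast
    have "\<bar>\<sigma> n i - x i\<bar> \<le> \<epsilon>" if n: "n \<ge> M" for n i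
    proof (rule tendsto_upperbound)
      show "(\<lambda>n'. \<bar>\<sigma> n i - \<sigma> n' i\<bar>) \<longlonglongrightarrow> \<bar>\<sigma> n i - x i\<bar>"
        using x by (intro tendsto_intros)
      show "eventually (\<lambda>n'. \<bar>\<sigma> n i - \<sigma> n' i\<bar> \<le> \<epsilon>) sequentially"
        unfolding eventually_sequentially
        using M n coord[of n i] by (intro exI[of _ M] allI impI) (meson less_imp_le order_trans)
    qed simp
    then show ?thesis by blast
  qed
  have "evens x \<in> Y"
    unfolding Y_def
  proof (rule null_kernel_uniform_limit[OF _ summable_ratio])
    show "\<bar>a i k / \<kappa> i\<bar> \<le> l i / \<kappa> i" for i k
      using entry_le[of i k] weight_pos[of i] by (simp add: abs_divide divide_right_mono)
    fix \<epsilon> :: real assume "0 < \<epsilon>"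
    then obtain M where M: "\<forall>n\<ge>M. \<forall>i. \<bar>\<sigma> n i - x i\<bar> \<le> \<epsilon>" using unif by blast
    show "\<exists>u\<in>null_kernel (\<lambda>i k. a i k / \<kappa> i). \<forall>i. \<bar>u i - evens x i\<bar> \<le> \<epsilon>"
      using M in_X[of M] by (intro bexI[of _ "evens (\<sigma> M)"]) (auto simp: evens_def X_iff Y_def)
  qed
  moreover have "odds x \<in> Z"
    unfolding Z_def
  proof (rule null_kernel_uniform_limit[OF entry_le summable_l])
    fix \<epsilon> :: real assume "0 < \<epsilon>"
    then obtain M where M: "\<forall>n\<ge>M. \<forall>i. \<bar>\<sigma> n i - x i\<bar> \<le> \<epsilon>" using unif by blast
    show "\<exists>u\<in>null_kernel a. \<forall>i. \<bar>u i - odds x i\<bar> \<le> \<epsilon>"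
      using M in_X[of M] by (intro bexI[of _ "odds (\<sigma> M)"]) (auto simp: odds_def X_iff Z_def)
  qed
  ultimately have xX: "x \<in> X" by (simp add: X_iff)
  have "\<exists>M. \<forall>n\<ge>M. \<sigma> n \<in> X \<and> vec_dist (\<sigma> n) x < \<epsilon>" if \<epsilon>: "0 < \<epsilon>" for \<epsilon>
  proof -
    obtain M where M: "\<forall>n\<ge>M. \<forall>i. \<bar>\<sigma> n i - x i\<bar> \<le> \<epsilon> / 8" using unif[of "\<epsilon> / 8"] \<epsilon> by auto
    have "vec_dist (\<sigma> n) x < \<epsilon>" if "n \<ge> M" for n
    proof -
      have "N (\<sigma> n - x) \<le> 4 * (\<epsilon> / 8)"
        using M that X_diff[OF in_X xX] by (intro N_le) (auto simp: evens_def odds_def)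
      then show ?thesis using \<epsilon> in_X xX by (simp add: vec_dist_def)
    qed
    then show ?thesis using in_X by blast
  qed
  then show "\<exists>x. limitin vec.mtopology \<sigma> x sequentially"
    using xX unfolding vec.limit_metric_sequentially by blast
qed

lemma banach_space_X: "banach_space_on seq_scale X N"
  by unfold_locales (rule mcomplete_X)

section \<open>Duality pairs and the numerical radius\<close>

lemma seq_scale_collapse: "seq_scale c (seq_scale d x) = seq_scale (c * d) x" "seq_scale 1 x = x"
  "seq_scale 0 x = 0" "seq_scale c 0 = 0"
  by (simp_all add: fun_eq_iff)

lemma X_closed: "0 \<in> X" "x \<in> X \<Longrightarrow> x' \<in> X \<Longrightarrow> x + x' \<in> X" "x \<in> X \<Longrightarrow> seq_scale c x \<in> X"
  by (auto simp: X_iff Z_closed Y_closed)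

lemma interleave_simps:
  "interleave y z + interleave y' z' = interleave (y + y') (z + z')"
  "interleave y z - interleave y' z' = interleave (y - y') (z - z')"
  "seq_scale c (interleave y z) = interleave (seq_scale c y) (seq_scale c z)"
  by (auto simp: interleave_def fun_eq_iff)

lemma operator_simps:
  assumes "S \<in> operators"
  shows "x \<in> X \<Longrightarrow> S x \<in> X" "x \<in> X \<Longrightarrow> x' \<in> X \<Longrightarrow> S (x + x') = S x + S x'"
    "x \<in> X \<Longrightarrow> S (seq_scale c x) = seq_scale c (S x)"
  using assms by (auto simp: operators_def bounded_linear_maps_def)

lemma operator_bound:
  assumes "S \<in> operators"
  obtains B where "0 \<le> B" "\<And>x. x \<in> X \<Longrightarrow> N (S x) \<le> B * N x"
proof -
  obtain B where B: "\<forall>x\<in>X. N (S x) \<le> B * N x"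
    using assms by (auto simp: operators_def bounded_linear_maps_def)
  have "N (S x) \<le> max B 0 * N x" if "x \<in> X" for x
    using B that N_nonneg[OF that] mult_right_mono[of B "max B 0" "N x"] by fastforce
  then show thesis using that[of "max B 0"] by simp
qed

lemma dual_simps:
  assumes "\<phi> \<in> dual_sphere"
  shows "x \<in> X \<Longrightarrow> x' \<in> X \<Longrightarrow> \<phi> (x + x') = \<phi> x + \<phi> x'"
    "x \<in> X \<Longrightarrow> \<phi> (seq_scale c x) = c * \<phi> x"
  using assms by (auto simp: dual_sphere_def dual_def bounded_linear_maps_def)

lemma dual_sphere_abs_le:
  assumes \<phi>: "\<phi> \<in> dual_sphere" and x: "x \<in> X"
  shows "\<bar>\<phi> x\<bar> \<le> N x"
proof (cases "x = 0")
  case True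
  then show ?thesis using dual_simps(2)[OF \<phi> x, of 0] by (simp add: seq_scale_collapse N_def)
next
  case False
  then have pos: "0 < N x" using N_nonneg[OF x] N_eq_0_iff[OF x] by auto
  obtain B where B: "\<forall>x\<in>X. norm (\<phi> x) \<le> B * N x"
    using \<phi> by (auto simp: dual_sphere_def dual_def bounded_linear_maps_def)
  have "bdd_above ((\<lambda>x. norm (\<phi> x)) ` unit_ball)"
  proof (rule bdd_aboveI2)
    fix y assume "y \<in> unit_ball"
    then have y: "y \<in> X" "N y \<le> 1" by (auto simp: unit_ball_def)
    have "norm (\<phi> y) \<le> B * N y" using B y by blast
    also have "\<dots> \<le> \<bar>B\<bar> * N y" using N_nonneg[OF y(1)] by (intro mult_right_mono) auto
    also have "\<dots> \<le> \<bar>B\<bar>" using y by (intro mult_left_le) auto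
    finally show "norm (\<phi> y) \<le> \<bar>B\<bar>" .
  qed
  moreover have "seq_scale (1 / N x) x \<in> unit_ball"
    using pos N_scale[OF x, of "1 / N x"] by (simp add: unit_ball_def X_closed x)
  ultimately have "norm (\<phi> (seq_scale (1 / N x) x)) \<le> map_norm norm \<phi>"
    unfolding map_norm_def by (rule cSUP_upper[rotated])
  then have "\<bar>\<phi> x\<bar> / N x \<le> 1"
    using \<phi> pos by (simp add: dual_simps(2)[OF \<phi> x] dual_sphere_def abs_mult)
  then show ?thesis using pos by (simp add: divide_le_eq)
qed

lemma duality_pairI:
  assumes add: "\<And>x x'. x \<in> X \<Longrightarrow> x' \<in> X \<Longrightarrow> \<psi> (x + x') = \<psi> x + \<psi> x'"
    and scale: "\<And>c x. x \<in> X \<Longrightarrow> \<psi> (seq_scale c x) = c * \<psi> x"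
    and le: "\<And>x. x \<in> X \<Longrightarrow> \<bar>\<psi> x\<bar> \<le> N x"
    and x0: "x0 \<in> X" "N x0 = 1" "\<psi> x0 = 1"
  shows "(x0, restrict \<psi> X) \<in> duality_pairs"
proof -
  let ?f = "restrict \<psi> X"
  have "?f \<in> dual"
    using add scale le by (auto simp: dual_def bounded_linear_maps_def X_closed intro!: exI[of _ 1])
  moreover have "map_norm norm ?f = 1"
    unfolding map_norm_def
  proof (rule cSup_eq_maximum)
    show "1 \<in> (\<lambda>x. norm (?f x)) ` unit_ball"
      using x0 by (intro image_eqI[of _ _ x0]) (auto simp: unit_ball_def)
    show "r \<le> 1" if "r \<in> (\<lambda>x. norm (?f x)) ` unit_ball" for r
      using that le by (auto simp: unit_ball_def intro: order_trans)
  qed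
  ultimately show ?thesis
    using x0 by (simp add: duality_pairs_def dual_sphere_def unit_sphere_def)
qed

lemma numerical_radius_upper:
  assumes S: "S \<in> operators" and "(x, \<phi>) \<in> duality_pairs"
  shows "\<bar>\<phi> (S x)\<bar> \<le> numerical_radius S"
proof -
  obtain B where B: "0 \<le> B" "\<And>x. x \<in> X \<Longrightarrow> N (S x) \<le> B * N x"
    using operator_bound[OF S] by blast
  have "bdd_above ((\<lambda>(x, f). norm (f (S x))) ` duality_pairs)"
  proof (rule bdd_aboveI2)
    fix p assume p: "p \<in> duality_pairs"
    obtain x f where "p = (x, f)" by (cases p)
    with p have x: "x \<in> X" "N x = 1" and f: "f \<in> dual_sphere"
      by (auto simp: duality_pairs_def unit_sphere_def)
    have "norm (f (S x)) \<le> N (S x)"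
      using dual_sphere_abs_le[OF f operator_simps(1)[OF S x(1)]] by simp
    also have "\<dots> \<le> B" using B(2)[OF x(1)] x by simp
    finally show "(case p of (x, f) \<Rightarrow> norm (f (S x))) \<le> B" using \<open>p = (x, f)\<close> by simp
  qed
  from cSUP_upper[OF assms(2) this] show ?thesis by (simp add: numerical_radius_def)
qed

text \<open>
  The homogeneous form of the definition of the numerical radius: a functional of norm 1 that
  norms \<open>x\<close> also norms \<open>x / N x\<close>.
\<close>

lemma rescaled_functional_bound:
  assumes S: "S \<in> operators" and \<phi>: "\<phi> \<in> dual_sphere" and x: "x \<in> X" "\<phi> x = N x"
  shows "\<bar>\<phi> (S x)\<bar> \<le> numerical_radius S * N x"
proof (cases "x = 0")
  case True
  have "\<phi> (S x) = 0"
    using True operator_simps(3)[OF S x(1), of 0] dual_simps(2)[OF \<phi> operator_simps(1)[OF S x(1)], of 0]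
    by (simp add: seq_scale_collapse)
  then show ?thesis using True by (simp add: N_def)
next
  case False
  then have pos: "0 < N x" using N_nonneg[OF x(1)] N_eq_0_iff[OF x(1)] by auto
  let ?x = "seq_scale (1 / N x) x"
  have "(?x, \<phi>) \<in> duality_pairs"
    using pos x \<phi> N_scale[OF x(1), of "1 / N x"]
    by (simp add: duality_pairs_def unit_sphere_def X_closed dual_simps(2)[OF \<phi>])
  then have "\<bar>\<phi> (S ?x)\<bar> \<le> numerical_radius S" by (rule numerical_radius_upper[OF S])
  then have "\<bar>\<phi> (S x)\<bar> / N x \<le> numerical_radius S"
    using pos x by (simp add: operator_simps(3)[OF S] dual_simps(2)[OF \<phi> operator_simps(1)[OF S x(1)]] abs_mult)
  then show ?thesis using pos by (simp add: divide_le_eq)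
qed

section \<open>The compact operator\<close>

definition T :: "(nat \<Rightarrow> real) \<Rightarrow> nat \<Rightarrow> real" where
  "T = restrict (\<lambda>x. interleave (\<lambda>i. \<kappa> i * odds x i) 0) X"

lemma weight_mult_in_Y:
  assumes "z \<in> Z"
  shows "(\<lambda>i. \<kappa> i * z i) \<in> Y"
proof -
  have "(\<lambda>i. \<kappa> i * z i) \<longlonglongrightarrow> 0 * 0"
    using assms weight_null Z_null by (intro tendsto_mult) (auto simp: null_seqs_def)
  moreover have "\<kappa> i * z i * (a i k / \<kappa> i) = z i * a i k" for i k
    using weight_pos[of i] by simp
  ultimately show ?thesis
    using assms by (simp add: Y_def Z_def null_kernel_def null_seqs_def)
qed

lemma row_in_Z: "a i \<in> Z"
  using row_null square_zero by (simp add: Z_def null_kernel_def null_seqs_def)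

lemma T_eq: "x \<in> X \<Longrightarrow> T x = interleave (\<lambda>i. \<kappa> i * odds x i) 0"
  by (simp add: T_def)

lemma T_in_X: "x \<in> X \<Longrightarrow> T x \<in> X"
  by (simp add: T_eq weight_mult_in_Y X_iff Z_closed)

lemma abs_weight_mult_le: "\<bar>\<kappa> i * r\<bar> \<le> \<bar>r\<bar>"
  using weight_pos[of i] weight_le_1[of i] by (simp add: abs_mult mult_left_le_one_le)

lemma T_operator: "T \<in> operators"
proof -
  have "T (x + x') = T x + T x'" if "x \<in> X" "x' \<in> X" for x x'
    using that by (simp add: T_eq X_closed interleave_simps) (auto simp: fun_eq_iff interleave_def algebra_simps)
  moreover have "T (seq_scale c x) = seq_scale c (T x)" if "x \<in> X" for c x
    using that by (simp add: T_eq X_closed interleave_simps) (auto simp: fun_eq_iff interleave_def algebra_simps)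
  moreover have "N (T x) \<le> 4 * N x" if x: "x \<in> X" for x
  proof (rule N_le)
    show "\<bar>evens (T x) i\<bar> \<le> N x" for i
      using abs_weight_mult_le[of i "odds x i"] abs_le_N(2)[OF x, of i] by (simp add: T_eq x)
    show "\<bar>odds (T x) i\<bar> \<le> N x" for i
      using N_nonneg[OF x] by (simp add: T_eq x)
  qed (use x in \<open>rule T_in_X\<close>)
  moreover have "T \<in> X \<rightarrow>\<^sub>E X"
    using T_in_X by (auto simp: T_def)
  ultimately show ?thesis
    unfolding operators_def bounded_linear_maps_def by blast
qed

text \<open>
  Up to \<open>\<epsilon>\<close> the image of \<open>x\<close> depends only on the first \<open>n\<close> coordinates of its \<open>Z\<close>-part, since
  later ones are multiplied by a small weight. Rounding those coordinates to a grid divides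
  the unit ball into finitely many cells, and one point from each cell gives a finite net.
\<close>

lemma totally_bounded_image: "vec.mtotally_bounded (T ` unit_ball)"
  unfolding vec.mtotally_bounded_def
proof (intro allI impI)
  fix \<epsilon> :: real assume \<epsilon>: "0 < \<epsilon>"
  define \<delta> where "\<delta> = \<epsilon> / 16"
  have \<delta>: "0 < \<delta>" using \<epsilon> by (simp add: \<delta>_def)
  obtain n where n: "\<And>i. i \<ge> n \<Longrightarrow> \<kappa> i < \<delta>"
    using LIMSEQ_D[OF weight_null \<delta>] weight_pos by (auto simp: abs_of_pos)
  \<comment> \<open>The cell of \<open>x\<close> is the grid cube of side \<open>\<delta>\<close> that contains its first \<open>n\<close> odd coordinates.\<close>
  define cell where "cell x = restrict (\<lambda>i. \<lfloor>odds x i / \<delta>\<rfloor>) {..<n}" for x :: "nat \<Rightarrow> real"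
  have coord: "\<bar>odds x i\<bar> \<le> 1" if "x \<in> unit_ball" for x i
    using that abs_le_N(2)[of x i] by (auto simp: unit_ball_def)
  have "cell ` unit_ball \<subseteq> {..<n} \<rightarrow>\<^sub>E {\<lfloor>- 1 / \<delta>\<rfloor>..\<lfloor>1 / \<delta>\<rfloor>}"
  proof (rule image_subsetI)
    fix x assume x: "x \<in> unit_ball"
    have "- 1 / \<delta> \<le> odds x i / \<delta>" "odds x i / \<delta> \<le> 1 / \<delta>" for i
      using coord[OF x, of i] \<delta> divide_right_mono[of "- 1" "odds x i" \<delta>]
        divide_right_mono[of "odds x i" 1 \<delta>] by auto
    then show "cell x \<in> {..<n} \<rightarrow>\<^sub>E {\<lfloor>- 1 / \<delta>\<rfloor>..\<lfloor>1 / \<delta>\<rfloor>}"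
      by (auto simp: cell_def intro!: floor_mono)
  qed
  then have fin: "finite (cell ` unit_ball)"
    by (rule finite_subset) (intro finite_PiE finite_lessThan ballI finite_atLeastAtMost_int)
  define pick where "pick c = (SOME x. x \<in> unit_ball \<and> cell x = c)" for c
  have pick: "pick (cell x) \<in> unit_ball" "cell (pick (cell x)) = cell x" if "x \<in> unit_ball" for x
    using someI[of "\<lambda>y. y \<in> unit_ball \<and> cell y = cell x" x] that by (auto simp: pick_def)
  have near: "vec_dist (T x') (T x) < \<epsilon>"
    if x: "x \<in> unit_ball" and x': "x' \<in> unit_ball" and eq: "cell x' = cell x" for x x'
  proof -
    have X: "x \<in> X" "x' \<in> X" using x x' by (auto simp: unit_ball_def)
    have "N (T x' - T x) \<le> 4 * (2 * \<delta>)"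
    proof (rule N_le)
      show "T x' - T x \<in> X" using X by (intro X_diff T_in_X)
      fix i
      show "\<bar>odds (T x' - T x) i\<bar> \<le> 2 * \<delta>" using X \<delta> by (simp add: T_eq)
      have "\<bar>\<kappa> i * (odds x' i - odds x i)\<bar> \<le> 2 * \<delta>"
      proof (cases "i < n")
        case True
        then have "\<lfloor>odds x' i / \<delta>\<rfloor> = \<lfloor>odds x i / \<delta>\<rfloor>"
          using fun_cong[OF eq, of i] by (simp add: cell_def)
        then have "\<bar>odds x' i / \<delta> - odds x i / \<delta>\<bar> < 1" by linarith
        then have "\<bar>odds x' i - odds x i\<bar> < \<delta>"
          using \<delta> by (simp add: diff_divide_distrib[symmetric] abs_divide divide_less_eq)
        then show ?thesis using abs_weight_mult_le[of i "odds x' i - odds x i"] \<delta> by linarith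
      next
        case False
        have "\<bar>odds x' i - odds x i\<bar> \<le> 2" using coord[OF x, of i] coord[OF x', of i] by linarith
        then have "\<kappa> i * \<bar>odds x' i - odds x i\<bar> \<le> \<delta> * 2"
          using n[of i] weight_pos[of i] False by (intro mult_mono) auto
        then show ?thesis using weight_pos[of i] by (simp add: abs_mult)
      qed
      then show "\<bar>evens (T x' - T x) i\<bar> \<le> 2 * \<delta>" using X by (simp add: T_eq right_diff_distrib)
    qed
    then show ?thesis using \<epsilon> X T_in_X by (simp add: vec_dist_def \<delta>_def)
  qed
  show "\<exists>K. finite K \<and> K \<subseteq> T ` unit_ball \<and> T ` unit_ball \<subseteq> (\<Union>x\<in>K. vec.mball x \<epsilon>)"
  proof (intro exI conjI)
    let ?K = "(\<lambda>c. T (pick c)) ` cell ` unit_ball"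
    show "finite ?K" using fin by simp
    show "?K \<subseteq> T ` unit_ball" using pick by blast
    show "T ` unit_ball \<subseteq> (\<Union>x\<in>?K. vec.mball x \<epsilon>)"
    proof (rule image_subsetI)
      fix x assume x: "x \<in> unit_ball"
      have "T x \<in> vec.mball (T (pick (cell x))) \<epsilon>"
        using near[OF x pick[OF x]] x pick(1)[OF x] T_in_X by (auto simp: unit_ball_def)
      then show "T x \<in> (\<Union>x\<in>?K. vec.mball x \<epsilon>)" using x by blast
    qed
  qed
qed

lemma T_compact: "T \<in> compact_operators"
  using vec.mtotally_bounded_eq_compact_closure_of[OF mcomplete_X] totally_bounded_image T_operator
  by (simp add: compact_operators_def)

section \<open>A trace that vanishes on finite-rank maps\<close>

text \<open>
  The coordinatewise bound is weaker than boundedness for the norm of \<open>Y\<close>, and it is all that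
  the trace functional needs to converge.
\<close>

definition bounded_map :: "((nat \<Rightarrow> real) \<Rightarrow> nat \<Rightarrow> real) \<Rightarrow> bool" where
  "bounded_map f \<longleftrightarrow> (\<forall>z\<in>Z. f z \<in> Y) \<and> (\<forall>z\<in>Z. \<forall>w\<in>Z. f (z + w) = f z + f w) \<and>
    (\<forall>c. \<forall>z\<in>Z. f (seq_scale c z) = seq_scale c (f z)) \<and>
    (\<exists>b\<ge>0. \<forall>z\<in>Z. \<forall>i. \<bar>f z i\<bar> \<le> b * sup_norm z)"

definition bounded_functional :: "((nat \<Rightarrow> real) \<Rightarrow> real) \<Rightarrow> bool" where
  "bounded_functional \<phi> \<longleftrightarrow> (\<forall>z\<in>Z. \<forall>w\<in>Z. \<phi> (z + w) = \<phi> z + \<phi> w) \<and>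
    (\<forall>c. \<forall>z\<in>Z. \<phi> (seq_scale c z) = c * \<phi> z) \<and>
    (\<exists>b\<ge>0. \<forall>z\<in>Z. \<bar>\<phi> z\<bar> \<le> b * sup_norm z)"

lemma bounded_map_simps:
  assumes "bounded_map f"
  shows "z \<in> Z \<Longrightarrow> f z \<in> Y" "z \<in> Z \<Longrightarrow> w \<in> Z \<Longrightarrow> f (z + w) = f z + f w"
    "z \<in> Z \<Longrightarrow> f (seq_scale c z) = seq_scale c (f z)"
  using assms unfolding bounded_map_def by blast+

lemma sup_norm_row_le: "sup_norm (a i) \<le> l i"
  using entry_le by (rule sup_norm_least)

text \<open>
  By continuity and linearity the partial sums are \<open>\<phi>\<close> applied to the partial sums of
  \<open>\<Sum>i. (y\<^sub>i / \<kappa>\<^sub>i) a\<^sub>i\<close>. This series converges absolutely in \<open>Z\<close>, and its sum is zero by the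
  definition of \<open>Y\<close>.
\<close>

lemma trace_rank_one:
  assumes \<phi>: "bounded_functional \<phi>" and y: "y \<in> Y"
  shows "(\<lambda>i. \<phi> (a i) * y i / \<kappa> i) sums 0"
proof -
  obtain b where b: "0 \<le> b" "\<And>z. z \<in> Z \<Longrightarrow> \<bar>\<phi> z\<bar> \<le> b * sup_norm z"
    using \<phi> unfolding bounded_functional_def by blast
  define s where "s n = (\<Sum>i<n. seq_scale (y i / \<kappa> i) (a i))" for n
  have s_Suc: "s (Suc n) = s n + seq_scale (y n / \<kappa> n) (a n)" for n by (simp add: s_def)
  have s_0: "s 0 = 0" by (simp add: s_def)
  have s_Z: "s n \<in> Z" for n
  proof (induction n)
    case (Suc n)
    then show ?case unfolding s_Suc by (intro Z_closed row_in_Z)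
  qed (simp only: s_0 zero_in)
  have \<phi>0: "\<phi> 0 = 0"
    using b(2)[OF Z_closed(1)] by simp
  have \<phi>_s: "\<phi> (s n) = (\<Sum>i<n. \<phi> (a i) * y i / \<kappa> i)" for n
  proof (induction n)
    case (Suc n)
    have "\<phi> (s (Suc n)) = \<phi> (s n) + (y n / \<kappa> n) * \<phi> (a n)"
      using \<phi> s_Z row_in_Z Z_closed unfolding bounded_functional_def s_Suc by simp
    then show ?case using Suc by simp
  qed (simp only: s_0 \<phi>0 lessThan_0 sum.empty)
  have s_apply: "s n k = (\<Sum>i<n. y i / \<kappa> i * a i k)" for n k
    by (induction n) (simp_all add: s_Suc s_0)
  have y_null: "y \<in> null_seqs" using y by (rule Y_null)
  have ratio_nonneg: "0 \<le> l i / \<kappa> i" for i using l_nonneg weight_pos[of i] by simp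
  have term_le: "\<bar>y i / \<kappa> i * a i k\<bar> \<le> sup_norm y * (l i / \<kappa> i)" for i k
  proof -
    have "\<bar>y i\<bar> * (\<bar>a i k\<bar> / \<kappa> i) \<le> sup_norm y * (l i / \<kappa> i)"
      using entry_le[of i k] weight_pos[of i] abs_le_sup_norm[OF y_null, of i] sup_norm_nonneg[OF y_null]
      by (intro mult_mono divide_right_mono) auto
    then show ?thesis using weight_pos[of i] by (simp add: abs_mult)
  qed
  define tail where "tail n = sup_norm y * (\<Sum>i. l (i + n) / \<kappa> (i + n))" for n
  have "sup_norm (s n) \<le> tail n" for n
  proof (rule sup_norm_least)
    fix k
    have sums: "(\<lambda>i. y i / \<kappa> i * a i k) sums 0"
      using y by (simp add: Y_def null_kernel_def)
    have "(\<lambda>i. y (i + n) / \<kappa> (i + n) * a (i + n) k) sums (0 - s n k)"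
      unfolding s_apply using sums by (rule sums_split_initial_segment)
    then have "\<bar>s n k\<bar> = norm (\<Sum>i. y (i + n) / \<kappa> (i + n) * a (i + n) k)"
      by (simp add: sums_iff)
    also have "\<dots> \<le> (\<Sum>i. sup_norm y * (l (i + n) / \<kappa> (i + n)))"
    proof (rule norm_suminf_le)
      show "norm (y (i + n) / \<kappa> (i + n) * a (i + n) k) \<le> sup_norm y * (l (i + n) / \<kappa> (i + n))" for i
        using term_le[of "i + n" k] by simp
      show "summable (\<lambda>i. sup_norm y * (l (i + n) / \<kappa> (i + n)))"
        using summable_ratio by (intro summable_mult summable_ignore_initial_segment)
    qed
    also have "\<dots> = tail n"
      unfolding tail_def using summable_ratio
      by (intro suminf_mult summable_ignore_initial_segment)
    finally show "\<bar>s n k\<bar> \<le> tail n" .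
  qed
  then have bound: "norm (\<phi> (s n)) \<le> b * tail n" for n
    using b(2)[OF s_Z, of n] b(1) by (simp add: order_trans[OF _ mult_left_mono])
  have "tail \<longlonglongrightarrow> sup_norm y * 0"
    unfolding tail_def using suminf_exist_split2[OF summable_ratio] by (rule tendsto_mult_left)
  then have "(\<lambda>n. b * tail n) \<longlonglongrightarrow> 0"
    using tendsto_mult_left[of tail 0 sequentially b] by simp
  then have "(\<lambda>n. \<phi> (s n)) \<longlonglongrightarrow> 0"
    using bound by (intro Lim_null_comparison[of "\<lambda>n. \<phi> (s n)"]) auto
  then show ?thesis unfolding \<phi>_s sums_def .
qed

lemma bounded_functional_coordinate: "bounded_functional (\<lambda>z. z i)"
  unfolding bounded_functional_def using abs_le_sup_norm[OF Z_null]
  by (auto intro!: exI[of _ 1])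

lemma bounded_functional_map_coordinate:
  assumes "bounded_map f"
  shows "bounded_functional (\<lambda>z. f z i / r)"
proof -
  obtain b where b: "0 \<le> b" "\<And>z i. z \<in> Z \<Longrightarrow> \<bar>f z i\<bar> \<le> b * sup_norm z"
    using assms unfolding bounded_map_def by blast
  have "\<bar>f z i / r\<bar> \<le> b / \<bar>r\<bar> * sup_norm z" if "z \<in> Z" for z
    using divide_right_mono[OF b(2)[OF that, of i], of "\<bar>r\<bar>"] by (simp add: abs_divide)
  then show ?thesis
    using assms b(1) unfolding bounded_functional_def bounded_map_def
    by (auto simp: add_divide_distrib intro!: exI[of _ "b / \<bar>r\<bar>"])
qed

lemma bounded_map_minus_rank_one:
  assumes f: "bounded_map f" and \<phi>: "bounded_functional \<phi>" and y: "y \<in> Y"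
  shows "bounded_map (\<lambda>z. f z - seq_scale (\<phi> z) y)"
proof -
  obtain b where b: "0 \<le> b" "\<And>z i. z \<in> Z \<Longrightarrow> \<bar>f z i\<bar> \<le> b * sup_norm z"
    using f unfolding bounded_map_def by blast
  obtain b' where b': "0 \<le> b'" "\<And>z. z \<in> Z \<Longrightarrow> \<bar>\<phi> z\<bar> \<le> b' * sup_norm z"
    using \<phi> unfolding bounded_functional_def by blast
  have yn: "y \<in> null_seqs" using y by (rule Y_null)
  have "\<bar>(f z - seq_scale (\<phi> z) y) i\<bar> \<le> (b + b' * sup_norm y) * sup_norm z" if z: "z \<in> Z" for z i
  proof -
    have "\<bar>\<phi> z * y i\<bar> \<le> (b' * sup_norm z) * sup_norm y"
      using b'(2)[OF z] abs_le_sup_norm[OF yn, of i] by (simp add: abs_mult mult_mono')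
    then show ?thesis using b(2)[OF z, of i] by (simp add: algebra_simps)
  qed
  moreover have "0 \<le> b + b' * sup_norm y" using b b' sup_norm_nonneg[OF yn] by simp
  moreover have "f z - seq_scale (\<phi> z) y \<in> Y" if "z \<in> Z" for z
    using f y that unfolding bounded_map_def by (intro Y_closed) auto
  ultimately show ?thesis
    using f \<phi> unfolding bounded_map_def bounded_functional_def
    by (auto simp: fun_eq_iff algebra_simps)
qed

lemma trace_minus_rank_one:
  assumes "bounded_functional \<phi>" "y \<in> Y"
    and "(\<lambda>i. (f (a i) - seq_scale (\<phi> (a i)) y) i / \<kappa> i) sums 0"
  shows "(\<lambda>i. f (a i) i / \<kappa> i) sums 0"
  using sums_add[OF assms(3) trace_rank_one[OF assms(1,2)]]
  by (simp add: diff_divide_distrib)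

text \<open>
  A map that vanishes on the sequences starting with \<open>n\<close> zeros has finite rank. It is reduced
  to zero by subtracting at most one rank-one map for each of the \<open>n\<close> coordinates, which
  leaves the trace unchanged.
\<close>

lemma trace_vanishing_on_tails:
  assumes "bounded_map f" "\<And>w. w \<in> Z \<Longrightarrow> (\<forall>i<n. w i = 0) \<Longrightarrow> f w = 0"
  shows "(\<lambda>i. f (a i) i / \<kappa> i) sums 0"
  using assms
proof (induction n arbitrary: f)
  case 0
  then show ?case using row_in_Z by simp
next
  case (Suc n)
  show ?case
  proof (cases "\<exists>u\<in>Z. (\<forall>i<n. u i = 0) \<and> u n \<noteq> 0")
    case False
    have "f w = 0" if "w \<in> Z" "\<forall>i<n. w i = 0" for w
    proof (rule Suc.prems(2)[OF that(1)])
      show "\<forall>i<Suc n. w i = 0" using that False by (auto simp: less_Suc_eq)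
    qed
    then show ?thesis using Suc.IH[OF Suc.prems(1)] by blast
  next
    case True
    then obtain u where u: "u \<in> Z" "\<forall>i<n. u i = 0" "u n \<noteq> 0" by blast
    \<comment> \<open>The rank-one map \<open>z \<mapsto> z\<^sub>n y\<close> agrees with \<open>f\<close> at \<open>u\<close>.\<close>
    define y where "y = seq_scale (1 / u n) (f u)"
    have y: "y \<in> Y" using u Suc.prems(1) by (auto simp: y_def bounded_map_def intro: Y_closed)
    let ?g = "\<lambda>z. f z - seq_scale (z n) y"
    have "bounded_map ?g"
      by (intro bounded_map_minus_rank_one Suc.prems(1) bounded_functional_coordinate y)
    moreover have "?g w = 0" if w: "w \<in> Z" "\<forall>i<n. w i = 0" for w
    proof -
      \<comment> \<open>The \<open>n\<close>-th coordinate of \<open>w\<close> is removed with the help of \<open>u\<close>.\<close>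
      let ?v = "w + seq_scale (- w n / u n) u"
      have su: "seq_scale (- w n / u n) u \<in> Z" using u(1) by (rule Z_closed)
      have "f ?v = 0"
      proof (rule Suc.prems(2))
        show "?v \<in> Z" using w(1) su by (rule Z_closed)
        show "\<forall>i<Suc n. ?v i = 0" using w(2) u(2,3) by (auto simp: less_Suc_eq)
      qed
      then have "f w + seq_scale (- w n / u n) (f u) = 0"
        using bounded_map_simps[OF Suc.prems(1)] w(1) su u(1) by metis
      then have "f w i - w n / u n * f u i = 0" for i by (simp add: fun_eq_iff)
      then show ?thesis by (simp add: y_def fun_eq_iff)
    qed
    ultimately have "(\<lambda>i. ?g (a i) i / \<kappa> i) sums 0" by (rule Suc.IH)
    then show ?thesis
      using trace_minus_rank_one[OF bounded_functional_coordinate y] by blast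
  qed
qed

text \<open>
  Subtracting one further rank-one map, built from a coordinate at which \<open>y\<close> does not vanish,
  makes the map vanish on the sequences starting with \<open>n\<close> zeros.
\<close>

lemma trace_finite_rank:
  assumes f: "bounded_map f" and y: "y \<in> Y"
    and tail: "\<And>w. w \<in> Z \<Longrightarrow> (\<forall>i<n. w i = 0) \<Longrightarrow> \<exists>c. f w = seq_scale c y"
  shows "(\<lambda>i. f (a i) i / \<kappa> i) sums 0"
proof (cases "y = 0")
  case True
  then show ?thesis using f tail by (intro trace_vanishing_on_tails[of f n]) (auto simp: seq_scale_collapse)
next
  case False
  then obtain k where k: "y k \<noteq> 0" by (auto simp: fun_eq_iff)
  let ?\<phi> = "\<lambda>z. f z k / y k"
  have \<phi>: "bounded_functional ?\<phi>" by (rule bounded_functional_map_coordinate[OF f])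
  have "f w - seq_scale (?\<phi> w) y = 0" if "w \<in> Z" "\<forall>i<n. w i = 0" for w
    using tail[OF that] k by (auto simp: fun_eq_iff)
  then have "(\<lambda>i. (f (a i) - seq_scale (?\<phi> (a i)) y) i / \<kappa> i) sums 0"
    by (intro trace_vanishing_on_tails[of "\<lambda>z. f z - seq_scale (?\<phi> z) y" n]
        bounded_map_minus_rank_one f \<phi> y) auto
  then show ?thesis by (rule trace_minus_rank_one[OF \<phi> y])
qed

section \<open>Operators attaining their numerical radius near the compact operator\<close>

text \<open>
  The block of \<open>S\<close> that maps \<open>Z\<close> to \<open>Y\<close>.
\<close>

definition corner :: "((nat \<Rightarrow> real) \<Rightarrow> nat \<Rightarrow> real) \<Rightarrow> (nat \<Rightarrow> real) \<Rightarrow> nat \<Rightarrow> real" where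
  "corner S z = evens (S (interleave 0 z))"

lemma interleave_0_in_X: "z \<in> Z \<Longrightarrow> interleave 0 z \<in> X"
  by (simp add: Y_closed)

lemma interleave_0_add: "interleave 0 (z + w) = interleave 0 z + interleave 0 w"
  and interleave_0_scale: "interleave 0 (seq_scale c z) = seq_scale c (interleave 0 z)"
  by (simp_all add: interleave_simps seq_scale_collapse)

lemma bounded_map_corner:
  assumes S: "S \<in> operators"
  shows "bounded_map (corner S)"
proof -
  obtain B where B: "0 \<le> B" "\<And>x. x \<in> X \<Longrightarrow> N (S x) \<le> B * N x"
    using operator_bound[OF S] by blast
  have "\<bar>corner S z i\<bar> \<le> B * sup_norm z" if "z \<in> Z" for z i
    using abs_le_N(1)[OF operator_simps(1)[OF S interleave_0_in_X[OF that]], of i] B(2)[OF interleave_0_in_X[OF that]]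
    by (simp add: corner_def)
  moreover have "corner S z \<in> Y" if "z \<in> Z" for z
    using operator_simps(1)[OF S interleave_0_in_X[OF that]] by (simp add: corner_def X_iff)
  ultimately show ?thesis
    using B(1) unfolding bounded_map_def
    by (auto simp: corner_def interleave_0_add interleave_0_scale operator_simps[OF S] interleave_0_in_X)
qed

lemma op_dist_bound:
  assumes S: "S \<in> operators" and x: "x \<in> X"
  shows "N (S x - T x) \<le> op_dist T S * N x"
proof (cases "x = 0")
  case True
  then have "S x = 0" "T x = 0"
    using operator_simps(3)[OF S x, of 0] operator_simps(3)[OF T_operator x, of 0]
    by (simp_all add: seq_scale_collapse)
  then show ?thesis using True by (simp add: N_def)
next
  case False
  then have pos: "0 < N x" using N_nonneg[OF x] N_eq_0_iff[OF x] by auto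
  let ?x = "seq_scale (1 / N x) x"
  have ball: "?x \<in> unit_ball"
    using pos N_scale[OF x, of "1 / N x"] by (simp add: unit_ball_def X_closed x)
  have in_X: "S x - T x \<in> X"
    by (rule X_diff[OF operator_simps(1)[OF S x] operator_simps(1)[OF T_operator x]])
  have x1: "?x \<in> X" using x by (rule X_closed)
  have "N (T ?x - S ?x) \<le> op_dist T S"
    using cSUP_upper[OF ball operator_diff_bdd[OF T_operator S]] S T_operator
    by (simp add: op_dist_def map_norm_def)
  moreover have "N (T ?x - S ?x) = N (S ?x - T ?x)"
    by (rule N_minus_commute[OF operator_simps(1)[OF T_operator x1] operator_simps(1)[OF S x1]])
  moreover have "S ?x - T ?x = seq_scale (1 / N x) (S x - T x)"
    using operator_simps(3)[OF S x] operator_simps(3)[OF T_operator x]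
    by (simp add: fun_eq_iff right_diff_distrib)
  ultimately have "N (S x - T x) / N x \<le> op_dist T S"
    using N_scale[OF in_X, of "1 / N x"] pos by simp
  then show ?thesis using pos by (simp add: divide_le_eq)
qed

text \<open>
  At a point \<open>(0, z)\<close> of an \<open>\<ell>\<^sub>1\<close>-sum a supporting functional is made of any functional \<open>J\<close> of
  norm at most 1 on the first summand and any functional supporting \<open>z\<close> on the second. Thus
  \<open>J\<close> may be chosen freely to test the corner of \<open>S\<close>.
\<close>

lemma test_pair_bound:
  assumes S: "S \<in> operators" and z: "z \<in> Z" "sup_norm z = 1" "\<zeta> z = 1"
    and J: "\<And>v w. v \<in> Y \<Longrightarrow> w \<in> Y \<Longrightarrow> J (v + w) = J v + J w"
      "\<And>c v. v \<in> Y \<Longrightarrow> J (seq_scale c v) = c * J v" "\<And>v. v \<in> Y \<Longrightarrow> \<bar>J v\<bar> \<le> rotund_norm v"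
    and \<zeta>: "\<And>v w. v \<in> Z \<Longrightarrow> w \<in> Z \<Longrightarrow> \<zeta> (v + w) = \<zeta> v + \<zeta> w"
      "\<And>c v. v \<in> Z \<Longrightarrow> \<zeta> (seq_scale c v) = c * \<zeta> v" "\<And>v. v \<in> Z \<Longrightarrow> \<bar>\<zeta> v\<bar> \<le> sup_norm v"
  shows "\<bar>J (corner S z) + \<zeta> (odds (S (interleave 0 z)))\<bar> \<le> numerical_radius S"
proof -
  let ?\<psi> = "\<lambda>x. J (evens x) + \<zeta> (odds x)"
  have "J 0 = 0" using J(3)[OF Y_closed(1)] by simp
  have "(interleave 0 z, restrict ?\<psi> X) \<in> duality_pairs"
  proof (rule duality_pairI)
    show "?\<psi> (x + x') = ?\<psi> x + ?\<psi> x'" if "x \<in> X" "x' \<in> X" for x x'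
      using that J(1) \<zeta>(1) by (simp add: X_iff)
    show "?\<psi> (seq_scale c x) = c * ?\<psi> x" if "x \<in> X" for c x
      using that J(2) \<zeta>(2) by (simp add: X_iff distrib_left)
    show "\<bar>?\<psi> x\<bar> \<le> N x" if "x \<in> X" for x
      using J(3)[of "evens x"] \<zeta>(3)[of "odds x"] that by (simp add: X_iff N_def)
  qed (use z \<open>J 0 = 0\<close> in \<open>simp_all add: interleave_0_in_X\<close>)
  from numerical_radius_upper[OF S this] show ?thesis
    using operator_simps(1)[OF S interleave_0_in_X[OF z(1)]] by (simp add: corner_def)
qed

lemma interleave_0_eq_0: "interleave 0 z = 0 \<Longrightarrow> z = 0"
  by (metis evens_odds_simps(8) odds_interleave)

lemma obtain_peak:
  obtains z k where "z \<in> Z" "sup_norm z = 1" "z k = 1"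
proof -
  obtain i where i: "a i i \<noteq> 0"
  proof (rule ccontr)
    assume "\<not> thesis"
    then have "a i i = 0" for i using that by blast
    then show False using trace_one sums_zero sums_unique2 by (metis (no_types, lifting) sums_cong zero_neq_one)
  qed
  have null: "a i \<in> null_seqs" using row_in_Z by (rule Z_null)
  obtain k where k: "\<bar>a i k\<bar> = sup_norm (a i)" using sup_norm_attained[OF null] .
  have "a i k \<noteq> 0" using k abs_le_sup_norm[OF null, of i] i by auto
  show thesis
  proof (rule that)
    show "seq_scale (1 / a i k) (a i) \<in> Z" using row_in_Z by (rule Z_closed)
    show "sup_norm (seq_scale (1 / a i k) (a i)) = 1"
      using \<open>a i k \<noteq> 0\<close> unfolding sup_norm_scale[OF null] k[symmetric] by simp
    show "seq_scale (1 / a i k) (a i) k = 1" using \<open>a i k \<noteq> 0\<close> by simp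
  qed
qed

text \<open>
  The trace of the corner of \<open>T\<close> is the trace of \<open>a\<close>, namely 1, and the trace is a bounded
  functional of the operator. So an operator whose corner has trace 0 cannot be too close to
  \<open>T\<close>.
\<close>

lemma trace_near:
  assumes S: "S \<in> operators" and zero: "(\<lambda>i. corner S (a i) i / \<kappa> i) sums 0"
  shows "1 \<le> op_dist T S * (\<Sum>i. l i / \<kappa> i)"
proof -
  have "(\<lambda>i. a i i - corner S (a i) i / \<kappa> i) sums (1 - 0)"
    using trace_one zero by (rule sums_diff)
  then have "1 = norm (\<Sum>i. a i i - corner S (a i) i / \<kappa> i)" by (simp add: sums_iff)
  also have "\<dots> \<le> (\<Sum>i. op_dist T S * (l i / \<kappa> i))"
  proof (rule norm_suminf_le)
    fix i
    let ?x = "interleave 0 (a i)"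
    have x: "?x \<in> X" by (simp add: row_in_Z)
    have "\<bar>evens (S ?x - T ?x) i\<bar> \<le> N (S ?x - T ?x)"
      by (rule abs_le_N(1)[OF X_diff[OF operator_simps(1)[OF S x] operator_simps(1)[OF T_operator x]]])
    also have "\<dots> \<le> op_dist T S * N ?x" by (rule op_dist_bound[OF S x])
    also have "\<dots> \<le> op_dist T S * l i"
      using sup_norm_row_le[of i] op.nonneg by (intro mult_left_mono) auto
    finally have le: "\<bar>corner S (a i) i - \<kappa> i * a i i\<bar> \<le> op_dist T S * l i"
      by (simp add: corner_def T_eq[OF x])
    have "a i i - corner S (a i) i / \<kappa> i = - (corner S (a i) i - \<kappa> i * a i i) / \<kappa> i"
      using weight_pos[of i] by (simp add: field_simps)
    then show "norm (a i i - corner S (a i) i / \<kappa> i) \<le> op_dist T S * (l i / \<kappa> i)"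
      using divide_right_mono[OF le[unfolded abs_minus_commute[of "corner S (a i) i"]], of "\<kappa> i"]
        weight_pos[of i] by (simp add: abs_divide)
    show "summable (\<lambda>i. op_dist T S * (l i / \<kappa> i))" using summable_ratio by (rule summable_mult)
  qed
  also have "\<dots> = op_dist T S * (\<Sum>i. l i / \<kappa> i)" using summable_ratio by (rule suminf_mult)
  finally show ?thesis .
qed

text \<open>
  Pair the point \<open>(0, z)\<close> with the coordinate functional at \<open>k\<close> on both summands. At \<open>T\<close> it
  takes the value \<open>\<kappa> k\<close>, and \<open>S\<close> differs from \<open>T\<close> by at most their distance.
\<close>

lemma numerical_radius_lower:
  assumes S: "S \<in> operators" and z: "z \<in> Z" "sup_norm z = 1" "z k = 1"
  shows "\<kappa> k - op_dist T S \<le> numerical_radius S"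
proof -
  let ?x = "interleave 0 z"
  have x: "?x \<in> X" using z by simp
  have bound: "\<bar>v k\<bar> \<le> rotund_norm v" if "v \<in> Y" for v
    using abs_le_sup_norm[OF Y_null[OF that], of k] rotund_norm_bounds(1)[OF Y_null[OF that]] by linarith
  have diff: "S ?x - T ?x \<in> X"
    by (rule X_diff[OF operator_simps(1)[OF S x] operator_simps(1)[OF T_operator x]])
  have "\<bar>corner S z k + odds (S ?x) k\<bar> \<le> numerical_radius S"
    using S z(1,2) bound abs_le_sup_norm[OF Z_null]
    by (intro test_pair_bound[where J = "\<lambda>v. v k" and \<zeta> = "\<lambda>v. v k"]) (auto simp: z(3))
  moreover have "\<bar>(corner S z k - \<kappa> k) + odds (S ?x) k\<bar> \<le> op_dist T S"
  proof -
    have "\<bar>evens (S ?x - T ?x) k\<bar> \<le> rotund_norm (evens (S ?x - T ?x))"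
      "\<bar>odds (S ?x - T ?x) k\<bar> \<le> sup_norm (odds (S ?x - T ?x))"
      using diff bound abs_le_sup_norm Z_null unfolding X_iff by blast+
    then have "\<bar>evens (S ?x - T ?x) k\<bar> + \<bar>odds (S ?x - T ?x) k\<bar> \<le> N (S ?x - T ?x)"
      by (simp add: N_def)
    also have "\<dots> \<le> op_dist T S" using op_dist_bound[OF S x] z by simp
    finally show ?thesis by (simp add: T_eq[OF x] corner_def z(3))
  qed
  ultimately show ?thesis by linarith
qed

text \<open>
  If \<open>\<phi>\<close> supports \<open>x = (y, z)\<close>, then it supports \<open>(y, 0)\<close> and \<open>(0, z)\<close> separately, because
  \<open>N x\<close> is the sum of their norms. Since \<open>\<phi> (S x)\<close> is also the sum of the two parts, each part
  must be maximal in absolute value for its norm. The part \<open>z\<close> is not zero: \<open>T\<close> vanishes at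
  \<open>(y, 0)\<close>, so \<open>S\<close> is too small there.
\<close>

lemma attained_at_Z:
  assumes S: "S \<in> operators" and pair: "(x, \<phi>) \<in> duality_pairs"
    and att: "\<bar>\<phi> (S x)\<bar> = numerical_radius S" and big: "op_dist T S < numerical_radius S"
  obtains z where "z \<in> Z" "sup_norm z = 1" "(interleave 0 z, \<phi>) \<in> duality_pairs"
    "numerical_radius S \<le> \<bar>\<phi> (S (interleave 0 z))\<bar>"
proof -
  have \<phi>: "\<phi> \<in> dual_sphere" and x: "x \<in> X" "N x = 1" "\<phi> x = 1"
    using pair by (auto simp: duality_pairs_def unit_sphere_def)
  let ?v = "numerical_radius S"
  let ?y = "interleave (evens x) 0" and ?z = "interleave 0 (odds x)"
  have yz: "?y \<in> X" "?z \<in> X" "?y + ?z = x"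
    using x(1) by (simp_all add: X_iff interleave_simps interleave_evens_odds)
  have Nyz: "N ?y + N ?z = 1" using x(2) by (simp add: N_def)
  have "\<phi> ?y + \<phi> ?z = 1" using dual_simps(1)[OF \<phi> yz(1,2)] yz(3) x(3) by simp
  then have \<phi>y: "\<phi> ?y = N ?y" and \<phi>z: "\<phi> ?z = N ?z"
    using dual_sphere_abs_le[OF \<phi> yz(1)] dual_sphere_abs_le[OF \<phi> yz(2)] Nyz by linarith+
  have split: "\<phi> (S x) = \<phi> (S ?y) + \<phi> (S ?z)"
    using operator_simps(2)[OF S yz(1,2)] dual_simps(1)[OF \<phi> operator_simps(1)[OF S yz(1)] operator_simps(1)[OF S yz(2)]]
      yz(3) by simp
  have le: "\<bar>\<phi> (S ?y)\<bar> \<le> ?v * N ?y" by (rule rescaled_functional_bound[OF S \<phi> yz(1) \<phi>y])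
  have "\<bar>\<phi> (S x)\<bar> \<le> \<bar>\<phi> (S ?y)\<bar> + \<bar>\<phi> (S ?z)\<bar>" unfolding split by (rule abs_triangle_ineq)
  moreover have "?v = ?v * N ?y + ?v * N ?z" using Nyz by (metis distrib_left mult.right_neutral)
  ultimately have ge: "?v * N ?z \<le> \<bar>\<phi> (S ?z)\<bar>" using att le by linarith
  have pos: "0 < N ?z"
  proof (rule ccontr)
    assume "\<not> 0 < N ?z"
    then have "N ?z = 0" using N_nonneg[OF yz(2)] by linarith
    then have "?z = 0" using N_eq_0_iff[OF yz(2)] by blast
    then have "odds x = 0" by (rule interleave_0_eq_0)
    then have "T x = 0"
      unfolding T_eq[OF x(1)] by (intro interleave_eqI[of _ 0, rule_format]) (simp_all add: fun_eq_iff)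
    then have "N (S x) \<le> op_dist T S" using op_dist_bound[OF S x(1)] x(2) by simp
    then have "\<bar>\<phi> (S x)\<bar> \<le> op_dist T S"
      using dual_sphere_abs_le[OF \<phi> operator_simps(1)[OF S x(1)]] by linarith
    then show False using att big by linarith
  qed
  let ?r = "N ?z"
  let ?w = "seq_scale (1 / ?r) (odds x)"
  have w: "interleave 0 ?w = seq_scale (1 / ?r) ?z" by (rule interleave_0_scale)
  have wX: "interleave 0 ?w \<in> X" unfolding w using yz(2) by (rule X_closed)
  show thesis
  proof (rule that)
    show "?w \<in> Z" using wX by simp
    have "N (interleave 0 ?w) = 1" unfolding w using pos N_scale[OF yz(2), of "1 / ?r"] by simp
    then show "sup_norm ?w = 1" by simp
    have "\<phi> (interleave 0 ?w) = 1" unfolding w using pos \<phi>z by (simp add: dual_simps(2)[OF \<phi> yz(2)])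
    then show "(interleave 0 ?w, \<phi>) \<in> duality_pairs"
      using \<phi> wX \<open>N (interleave 0 ?w) = 1\<close> unfolding duality_pairs_def unit_sphere_def by blast
    have "\<bar>\<phi> (S (interleave 0 ?w))\<bar> = \<bar>\<phi> (S ?z)\<bar> / ?r"
      unfolding w operator_simps(3)[OF S yz(2)] dual_simps(2)[OF \<phi> operator_simps(1)[OF S yz(2)]]
      using pos by (simp add: abs_mult)
    then show "?v \<le> \<bar>\<phi> (S (interleave 0 ?w))\<bar>" using ge pos by (simp add: le_divide_eq)
  qed
qed

text \<open>
  The functional \<open>\<phi>\<close> also supports \<open>z + w\<close> and \<open>z - w\<close>. Replacing its \<open>Y\<close>-part by norming
  functionals of \<open>B (z + w)\<close> and of \<open>B (z - w)\<close>, where \<open>B\<close> is the corner of \<open>S\<close>, gives two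
  lower bounds for the numerical radius, in which the contributions of \<open>w\<close> to the \<open>Z\<close>-part
  cancel. Comparing with the value attained at \<open>z\<close> yields
  \<open>\<parallel>B z + B w\<parallel> + \<parallel>B z - B w\<parallel> \<le> 2 \<parallel>B z\<parallel>\<close>.
\<close>

lemma corner_on_flat_direction:
  assumes S: "S \<in> operators" and z: "z \<in> Z" "sup_norm z = 1"
    and pair: "(interleave 0 z, \<phi>) \<in> duality_pairs"
    and att: "numerical_radius S \<le> \<bar>\<phi> (S (interleave 0 z))\<bar>"
    and w: "w \<in> Z" and flat: "sup_norm (z + w) \<le> 1" "sup_norm (z - w) \<le> 1"
  shows "\<exists>c. corner S w = seq_scale c (corner S z)"
proof -
  let ?v = "numerical_radius S"
  have \<phi>: "\<phi> \<in> dual_sphere" and \<phi>z: "\<phi> (interleave 0 z) = 1"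
    using pair by (auto simp: duality_pairs_def)
  define \<zeta> where "\<zeta> u = \<phi> (interleave 0 u)" for u
  define \<eta> where "\<eta> u = \<phi> (interleave u 0)" for u
  define g where "g u = odds (S (interleave 0 u))" for u
  note map = bounded_map_simps[OF bounded_map_corner[OF S]]
  have \<zeta>_add: "\<zeta> (u + u') = \<zeta> u + \<zeta> u'" if "u \<in> Z" "u' \<in> Z" for u u'
    using that dual_simps(1)[OF \<phi>] by (simp add: \<zeta>_def interleave_0_add)
  have \<zeta>_scale: "\<zeta> (seq_scale c u) = c * \<zeta> u" if "u \<in> Z" for c u
    using that dual_simps(2)[OF \<phi>] by (simp add: \<zeta>_def interleave_0_scale)
  have \<zeta>_le: "\<bar>\<zeta> u\<bar> \<le> sup_norm u" if "u \<in> Z" for u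
    using that dual_sphere_abs_le[OF \<phi>, of "interleave 0 u"] by (simp add: \<zeta>_def)
  have g_Z: "g u \<in> Z" if "u \<in> Z" for u
    using operator_simps(1)[OF S interleave_0_in_X[OF that]] by (simp add: g_def X_iff)
  have g_add: "g (u + u') = g u + g u'" if "u \<in> Z" "u' \<in> Z" for u u'
    using that by (simp add: g_def interleave_0_add operator_simps[OF S])
  have g_scale: "g (seq_scale c u) = seq_scale c (g u)" if "u \<in> Z" for c u
    using that by (simp add: g_def interleave_0_scale operator_simps[OF S])
  have neg: "z - w = z + seq_scale (- 1) w" by (simp add: fun_eq_iff)
  have nw: "seq_scale (- 1) w \<in> Z" using w by (rule Z_closed)
  have "\<zeta> (z - w) = \<zeta> z - \<zeta> w" unfolding neg \<zeta>_add[OF z(1) nw] \<zeta>_scale[OF w] by simp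
  moreover have "\<zeta> z = 1" using \<phi>z by (simp add: \<zeta>_def)
  moreover have pm: "z + w \<in> Z" "z - w \<in> Z" using z(1) w by (rule Z_closed)+
  moreover note \<zeta>_add[OF z(1) w] \<zeta>_le[OF pm(1)] \<zeta>_le[OF pm(2)] flat
  ultimately have pm1: "\<zeta> (z + w) = 1" "sup_norm (z + w) = 1" "\<zeta> (z - w) = 1" "sup_norm (z - w) = 1"
    by linarith+
  define q where "q = \<phi> (S (interleave 0 z))"
  have q: "q = \<eta> (corner S z) + \<zeta> (g z)"
  proof -
    have "S (interleave 0 z) = interleave (corner S z) 0 + interleave 0 (g z)"
      by (simp add: corner_def g_def interleave_simps interleave_evens_odds)
    then show ?thesis
      unfolding q_def \<eta>_def \<zeta>_def using dual_simps(1)[OF \<phi>] map(1)[OF z(1)] g_Z[OF z(1)] by simp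
  qed
  \<comment> \<open>The numerical radius only controls absolute values; \<open>s\<close> carries the sign of the attained value.\<close>
  define s where "s = (if 0 \<le> q then 1 else - 1 :: real)"
  have s: "s * s = 1" "?v \<le> s * q" using att by (auto simp: s_def q_def)
  have test: "rotund_norm (corner S u) + s * \<zeta> (g u) \<le> ?v"
    if u: "u \<in> Z" "sup_norm u = 1" "\<zeta> u = 1" for u
  proof -
    obtain J where J: "\<And>v w. v \<in> null_seqs \<Longrightarrow> w \<in> null_seqs \<Longrightarrow> J (v + w) = J v + J w"
      "\<And>c v. v \<in> null_seqs \<Longrightarrow> J (seq_scale c v) = c * J v"
      "\<And>v. v \<in> null_seqs \<Longrightarrow> \<bar>J v\<bar> \<le> rotund_norm v" "J (corner S u) = rotund_norm (corner S u)"
      using rotund_norm_norming[OF Y_null[OF map(1)[OF u(1)]]] by metis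
    have "\<bar>s\<bar> = 1" by (simp add: s_def)
    have "\<bar>s * J (corner S u) + \<zeta> (g u)\<bar> \<le> ?v"
      unfolding g_def
    proof (rule test_pair_bound[where J = "\<lambda>v. s * J v" and \<zeta> = \<zeta>, OF S u])
      show "s * J (v + w) = s * J v + s * J w" if "v \<in> Y" "w \<in> Y" for v w
        using that J(1) Y_null by (simp add: distrib_left)
      show "s * J (seq_scale c v) = c * (s * J v)" if "v \<in> Y" for c v
        using that J(2) Y_null by simp
      show "\<bar>s * J v\<bar> \<le> rotund_norm v" if "v \<in> Y" for v
        using that J(3) Y_null \<open>\<bar>s\<bar> = 1\<close> by (simp add: abs_mult)
    qed (fact \<zeta>_add \<zeta>_scale \<zeta>_le)+
    moreover have "s * t \<le> \<bar>t\<bar>" for t :: real by (auto simp: s_def)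
    ultimately have "s * (s * J (corner S u) + \<zeta> (g u)) \<le> ?v" by (meson order_trans)
    then show ?thesis using s(1) J(4) by (simp add: distrib_left flip: mult.assoc)
  qed
  let ?u = "corner S z" and ?w = "corner S w"
  have cp: "corner S (z + w) = ?u + ?w" by (rule map(2)[OF z(1) w])
  have cm: "corner S (z - w) = ?u - ?w"
    unfolding neg map(2)[OF z(1) nw] map(3)[OF w] by (simp add: fun_eq_iff)
  have gp: "\<zeta> (g (z + w)) = \<zeta> (g z) + \<zeta> (g w)"
    by (simp add: g_add[OF z(1) w] \<zeta>_add[OF g_Z[OF z(1)] g_Z[OF w]])
  have gm: "\<zeta> (g (z - w)) = \<zeta> (g z) - \<zeta> (g w)"
    unfolding neg g_add[OF z(1) nw] g_scale[OF w] \<zeta>_add[OF g_Z[OF z(1)] Z_closed(3)[OF g_Z[OF w]]]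
      \<zeta>_scale[OF g_Z[OF w]]
    by simp
  have "rotund_norm (?u + ?w) + s * (\<zeta> (g z) + \<zeta> (g w)) \<le> ?v"
    using test[OF pm(1) pm1(2,1)] unfolding cp gp .
  moreover have "rotund_norm (?u - ?w) + s * (\<zeta> (g z) - \<zeta> (g w)) \<le> ?v"
    using test[OF pm(2) pm1(4,3)] unfolding cm gm .
  moreover have "s * \<eta> ?u \<le> rotund_norm ?u"
  proof -
    have "\<bar>\<eta> ?u\<bar> \<le> rotund_norm ?u"
      using dual_sphere_abs_le[OF \<phi>, of "interleave ?u 0"] map(1)[OF z(1)] by (simp add: \<eta>_def)
    then show ?thesis by (auto simp: s_def)
  qed
  moreover have "?v \<le> s * \<eta> ?u + s * \<zeta> (g z)" using s(2) by (simp add: q distrib_left)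
  ultimately have "rotund_norm (?u + ?w) + rotund_norm (?u - ?w) \<le> 2 * rotund_norm ?u"
    by (simp add: distrib_left right_diff_distrib)
  then show ?thesis
    by (rule rotund_norm_strictly_convex[OF Y_null[OF map(1)[OF z(1)]] Y_null[OF map(1)[OF w]]])
qed

text \<open>
  From some coordinate on, the null sequence \<open>z\<close> is below \<open>1 / 2\<close>. A sequence that vanishes
  before that coordinate becomes, after scaling, a flat direction at \<open>z\<close>.
\<close>

lemma corner_on_tail:
  assumes S: "S \<in> operators" and z: "z \<in> Z" "sup_norm z = 1"
    and pair: "(interleave 0 z, \<phi>) \<in> duality_pairs"
    and att: "numerical_radius S \<le> \<bar>\<phi> (S (interleave 0 z))\<bar>"
  obtains n where "\<And>w. w \<in> Z \<Longrightarrow> (\<forall>i<n. w i = 0) \<Longrightarrow> \<exists>c. corner S w = seq_scale c (corner S z)"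
proof -
  have "z \<longlonglongrightarrow> 0" using Z_null[OF z(1)] by (simp add: null_seqs_def)
  then obtain n where n: "\<And>i. i \<ge> n \<Longrightarrow> \<bar>z i\<bar> < 1 / 2"
    using LIMSEQ_D[of z 0 "1 / 2"] by auto
  show thesis
  proof (rule that)
    fix w assume w: "w \<in> Z" "\<forall>i<n. w i = 0"
    note null = Z_null[OF w(1)]
    define r where "r = 2 * (sup_norm w + 1)"
    have r: "0 < r" using sup_norm_nonneg[OF null] by (simp add: r_def)
    let ?w = "seq_scale (1 / r) w"
    have wZ: "?w \<in> Z" using w(1) by (rule Z_closed)
    have small: "\<bar>?w i\<bar> \<le> 1 / 2" for i
      using abs_le_sup_norm[OF null, of i] r by (simp add: abs_mult divide_le_eq r_def)
    have "\<bar>z i\<bar> + \<bar>?w i\<bar> \<le> 1" for i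
    proof (cases "i < n")
      case True
      then show ?thesis using w(2) abs_le_sup_norm[OF Z_null[OF z(1)], of i] z(2) by simp
    next
      case False
      then show ?thesis using n[of i] small[of i] by linarith
    qed
    then have "\<bar>(z + ?w) i\<bar> \<le> 1" "\<bar>(z - ?w) i\<bar> \<le> 1" for i
      using abs_triangle_ineq[of "z i" "?w i"] abs_triangle_ineq4[of "z i" "?w i"]
      unfolding plus_fun_apply minus_apply by (meson order_trans)+
    then have "sup_norm (z + ?w) \<le> 1" "sup_norm (z - ?w) \<le> 1" by (blast intro: sup_norm_least)+
    then obtain c where "corner S ?w = seq_scale c (corner S z)"
      using corner_on_flat_direction[OF S z pair att wZ] by blast
    moreover have "corner S ?w = seq_scale (1 / r) (corner S w)"
      by (rule bounded_map_simps(3)[OF bounded_map_corner[OF S] w(1)])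
    ultimately have "seq_scale r (seq_scale (1 / r) (corner S w)) = seq_scale r (seq_scale c (corner S z))"
      by simp
    then have "corner S w = seq_scale (r * c) (corner S z)" using r by (simp add: seq_scale_collapse)
    then show "\<exists>c. corner S w = seq_scale c (corner S z)" ..
  qed
qed

lemma T_not_approximable: "T \<notin> op_topology closure_of NRA"
proof
  assume mem: "T \<in> op_topology closure_of NRA"
  obtain z\<^sub>0 k where z\<^sub>0: "z\<^sub>0 \<in> Z" "sup_norm z\<^sub>0 = 1" "z\<^sub>0 k = 1" by (rule obtain_peak)
  define M where "M = (\<Sum>i. l i / \<kappa> i)"
  have M: "0 \<le> M"
    unfolding M_def using summable_ratio l_nonneg weight_pos
    by (intro suminf_nonneg) (auto simp: less_imp_le)
  \<comment> \<open>The first bound makes \<open>attained_at_Z\<close> applicable, the second one contradicts \<open>trace_near\<close>.\<close>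
  define \<epsilon> where "\<epsilon> = min (\<kappa> k / 2) (1 / (M + 1))"
  have "0 < \<epsilon>" using weight_pos[of k] M by (simp add: \<epsilon>_def)
  then obtain S where S: "S \<in> NRA" "S \<in> op.mball T \<epsilon>"
    using mem unfolding op_topology_def op.metric_closure_of by blast
  then have op: "S \<in> operators" and dist: "op_dist T S < \<epsilon>" by auto
  obtain x \<phi> where att: "(x, \<phi>) \<in> duality_pairs" "\<bar>\<phi> (S x)\<bar> = numerical_radius S"
    using S(1) by (auto simp: NRA_def)
  have "op_dist T S < numerical_radius S"
    using numerical_radius_lower[OF op z\<^sub>0] dist by (simp add: \<epsilon>_def)
  then obtain z where z: "z \<in> Z" "sup_norm z = 1" "(interleave 0 z, \<phi>) \<in> duality_pairs"
    "numerical_radius S \<le> \<bar>\<phi> (S (interleave 0 z))\<bar>"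
    using attained_at_Z[OF op att] by blast
  obtain n where "\<And>w. w \<in> Z \<Longrightarrow> (\<forall>i<n. w i = 0) \<Longrightarrow> \<exists>c. corner S w = seq_scale c (corner S z)"
    using corner_on_tail[OF op z] by blast
  then have "(\<lambda>i. corner S (a i) i / \<kappa> i) sums 0"
    by (rule trace_finite_rank[OF bounded_map_corner[OF op] bounded_map_simps(1)[OF bounded_map_corner[OF op] z(1)]])
  then have "1 \<le> op_dist T S * M" unfolding M_def by (rule trace_near[OF op])
  also have "\<dots> \<le> 1 / (M + 1) * M" using dist M by (intro mult_right_mono) (auto simp: \<epsilon>_def)
  also have "\<dots> < 1" using M by (simp add: field_simps)
  finally show False by simp
qed

lemma X_nontrivial: "X \<noteq> {0}"
proof -
  obtain z k where z: "z \<in> Z" "sup_norm z = 1" "z k = 1" by (rule obtain_peak)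
  then have "interleave 0 z \<in> X" "interleave 0 z \<noteq> 0"
    using interleave_0_eq_0[of z] by auto
  then show ?thesis by blast
qed

end

section \<open>Sign sums over families of finite sets\<close>

text \<open>
  The nontrivial character of the two-element group, written on truth values.
\<close>

definition sign_of :: "bool \<Rightarrow> real" where
  "sign_of P = (if P then - 1 else 1)"

lemma sign_of_square [simp]: "sign_of P * sign_of P = 1"
  by (simp add: sign_of_def)

lemma sign_of_eq_iff [simp]: "sign_of P = sign_of Q \<longleftrightarrow> P = Q"
  by (simp add: sign_of_def)

lemma prod_sign:
  fixes f :: "'i \<Rightarrow> real"
  assumes "\<And>i. i \<in> A \<Longrightarrow> f i * f i = 1"
  shows "prod f A * prod f A = 1"
  using assms by (simp flip: prod.distrib)

lemma sign_cases:
  fixes s :: real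
  assumes "s * s = 1"
  obtains "s = 1" | "s = - 1"
  using assms by (metis square_eq_1_iff)

lemma sum_Pow_prod:
  fixes f :: "'i \<Rightarrow> real"
  assumes "finite U"
  shows "(\<Sum>A\<in>Pow U. prod f A) = (\<Prod>i\<in>U. 1 + f i)"
  using prod_add[OF assms, of f "\<lambda>_. 1"] by (simp add: add.commute)

lemma sum_Pow_sign:
  fixes f :: "'i \<Rightarrow> real"
  assumes "finite U" "\<And>i. i \<in> U \<Longrightarrow> f i * f i = 1"
  shows "(\<Sum>A\<in>Pow U. prod f A) = (if \<forall>i\<in>U. f i = 1 then 2 ^ card U else 0)"
proof (cases "\<forall>i\<in>U. f i = 1")
  case False
  then obtain i where i: "i \<in> U" "f i \<noteq> 1" by blast
  then have "1 + f i = 0" using assms(2)[OF i(1)] by (auto elim: sign_cases)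
  then have "(\<Prod>i\<in>U. 1 + f i) = 0" using i assms(1) by (meson prod_zero)
  then show ?thesis using False assms(1) by (simp add: sum_Pow_prod)
qed (use assms in \<open>simp add: sum_Pow_prod\<close>)

lemma prod_mem_flip:
  assumes "finite A" "finite B"
  shows "(\<Prod>i\<in>A. sign_of (i \<in> B)) = (\<Prod>i\<in>B. sign_of (i \<in> A))"
proof -
  have "(\<Prod>i\<in>A. sign_of (i \<in> B)) = (\<Prod>i\<in>A \<inter> B. - 1)"
    using assms unfolding sign_of_def by (subst prod.inter_restrict) auto
  also have "\<dots> = (\<Prod>i\<in>B \<inter> A. - 1)" by (simp add: Int_commute)
  also have "\<dots> = (\<Prod>i\<in>B. sign_of (i \<in> A))"
    using assms unfolding sign_of_def by (subst prod.inter_restrict) auto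
  finally show ?thesis .
qed

lemma prod_sign_mult:
  fixes f :: "'i \<Rightarrow> real"
  assumes "finite A" "finite B" "\<And>i. f i * f i = 1"
  shows "prod f A * prod f B = prod f (A - B \<union> (B - A))"
proof -
  have "prod f A = prod f (A - B) * prod f (A \<inter> B)"
    using assms by (subst prod.union_disjoint[symmetric]) (auto intro: prod.cong)
  moreover have "prod f B = prod f (B - A) * prod f (A \<inter> B)"
    using assms by (subst prod.union_disjoint[symmetric]) (auto intro: prod.cong)
  moreover have "prod f (A \<inter> B) * prod f (A \<inter> B) = 1"
    using assms by (intro prod_sign)
  moreover have "prod f (A - B \<union> (B - A)) = prod f (A - B) * prod f (B - A)"
    using assms by (intro prod.union_disjoint) auto
  ultimately show ?thesis by (simp add: algebra_simps)
qed

text \<open>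
  The condition is a linear system over the two-element field with a band matrix: row \<open>i\<close>
  involves the unknowns \<open>i + u\<close> with \<open>u \<in> c\<close>. The lowest offset \<open>t\<close> in \<open>c\<close> lets row \<open>j - t\<close>
  determine unknown \<open>j\<close> from later ones, so solutions are determined by at most four free
  unknowns.
\<close>

lemma card_band_solutions_le:
  fixes c :: "nat set" and k :: "nat \<Rightarrow> real"
  assumes c: "c \<subseteq> {..<4}" "c \<noteq> {}" and N: "N \<le> Suc n"
  shows "card {y \<in> Pow {..<N}. \<forall>i<n. k i * (\<Prod>u\<in>c. sign_of (i + u \<in> y)) = 1} \<le> 16"
proof -
  let ?S = "{y \<in> Pow {..<N}. \<forall>i<n. k i * (\<Prod>u\<in>c. sign_of (i + u \<in> y)) = 1}"
  let ?R = "insert n {..<3}"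
  \<comment> \<open>Row \<open>i\<close> starts at the unknown \<open>i + t\<close>.\<close>
  define t where "t = Min c"
  have fin: "finite c" using c(1) by (rule finite_subset) simp
  have t: "t \<in> c" "\<And>u. u \<in> c \<Longrightarrow> t \<le> u" using c(2) fin by (auto simp: t_def)
  have "t < 4" using t c by auto
  have "inj_on (\<lambda>y. y \<inter> ?R) ?S"
  proof (rule inj_onI)
    fix y y' assume y: "y \<in> ?S" and y': "y' \<in> ?S" and eq: "y \<inter> ?R = y' \<inter> ?R"
    have "j \<in> y \<longleftrightarrow> j \<in> y'" for j
    proof (induction "N - j" arbitrary: j rule: less_induct)
      case less
      consider "N \<le> j" | "j \<in> ?R" | "3 \<le> j" "j < n" "j < N" using N by fastforce
      then show ?case
      proof cases
        case 1
        then show ?thesis using y y' by auto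
      next
        case 2
        then show ?thesis using eq by blast
      next
        case 3
        define i where "i = j - t"
        have i: "i < n" "i + t = j" using 3 \<open>t < 4\<close> by (auto simp: i_def)
        let ?P = "\<lambda>y. \<Prod>u\<in>c. sign_of (i + u \<in> y)"
        let ?Q = "\<lambda>y. \<Prod>u\<in>c - {t}. sign_of (i + u \<in> y)"
        have split: "?P v = sign_of (j \<in> v) * ?Q v" for v
          using fin t i by (subst prod.remove[of c t]) auto
        have "?Q y = ?Q y'"
        proof (intro prod.cong refl)
          fix u assume "u \<in> c - {t}"
          then have "t < u" using t(2)[of u] by auto
          then have "N - (i + u) < N - j" using i(2) 3 by linarith
          then show "sign_of (i + u \<in> y) = sign_of (i + u \<in> y')" using less.hyps by simp
        qed
        moreover have "k i * ?P y = 1" "k i * ?P y' = 1" using y y' i by auto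
        ultimately have "(k i * ?Q y) * sign_of (j \<in> y) = 1" "(k i * ?Q y) * sign_of (j \<in> y') = 1"
          unfolding split by (simp_all add: ac_simps)
        then have "sign_of (j \<in> y) = sign_of (j \<in> y')"
          by (metis mult_cancel_left mult_zero_left zero_neq_one)
        then show ?thesis by simp
      qed
    qed
    then show "y = y'" by blast
  qed
  then have "card ?S = card ((\<lambda>y. y \<inter> ?R) ` ?S)" by (simp add: card_image)
  also have "\<dots> \<le> card (Pow ?R)" by (intro card_mono) auto
  also have "\<dots> = 2 ^ card ?R" by (rule card_Pow) simp
  also have "\<dots> \<le> 2 ^ 4" by (intro power_increasing) (simp_all add: card_insert_if)
  finally show ?thesis by simp
qed

text \<open>
  The inner sum over \<open>x\<close> of a product of signs vanishes unless all the signs are 1. For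
  \<open>i < n\<close> this is the band system above, so only boundedly many \<open>y\<close> survive. The trivial bound
  would be \<open>4 ^ N\<close>.
\<close>

lemma band_sum_le:
  fixes c :: "nat set" and k :: "nat \<Rightarrow> real" and w :: "nat set \<Rightarrow> real"
    and s :: "nat \<Rightarrow> nat set \<Rightarrow> real"
  assumes c: "c \<subseteq> {..<4}" "c \<noteq> {}" and N: "n \<le> N" "N \<le> Suc n"
    and w: "\<And>y. \<bar>w y\<bar> \<le> 1"
    and sign: "\<And>i y. s i y * s i y = 1"
    and band: "\<And>i y. i < n \<Longrightarrow> s i y = k i * (\<Prod>u\<in>c. sign_of (i + u \<in> y))"
  shows "\<bar>\<Sum>x\<in>Pow {..<N}. \<Sum>y\<in>Pow {..<N}. w y * (\<Prod>i\<in>x. s i y)\<bar> \<le> 16 * 2 ^ N"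
proof -
  let ?S = "{y \<in> Pow {..<N}. \<forall>i<n. k i * (\<Prod>u\<in>c. sign_of (i + u \<in> y)) = 1}"
  have "(\<Sum>x\<in>Pow {..<N}. \<Sum>y\<in>Pow {..<N}. w y * (\<Prod>i\<in>x. s i y))
      = (\<Sum>y\<in>Pow {..<N}. w y * (\<Sum>x\<in>Pow {..<N}. \<Prod>i\<in>x. s i y))"
    by (subst sum.swap) (simp add: sum_distrib_left)
  also have "\<bar>\<dots>\<bar> \<le> (\<Sum>y\<in>Pow {..<N}. if y \<in> ?S then 2 ^ N else 0)"
  proof (rule order_trans[OF sum_abs], rule sum_mono)
    fix y assume y: "y \<in> Pow {..<N}"
    let ?E = "\<Sum>x\<in>Pow {..<N}. \<Prod>i\<in>x. s i y"
    have E: "?E = (if \<forall>i\<in>{..<N}. s i y = 1 then 2 ^ N else 0)"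
      using sum_Pow_sign[of "{..<N}" "\<lambda>i. s i y"] sign by simp
    have "y \<in> ?S" if "\<forall>i\<in>{..<N}. s i y = 1"
      using that y N by (auto simp flip: band)
    then have "\<bar>?E\<bar> \<le> (if y \<in> ?S then 2 ^ N else 0)"
      unfolding E by auto
    moreover have "\<bar>w y * ?E\<bar> \<le> \<bar>?E\<bar>"
      using w[of y] by (simp add: abs_mult mult_left_le_one_le)
    ultimately show "\<bar>w y * ?E\<bar> \<le> (if y \<in> ?S then 2 ^ N else 0)" by linarith
  qed
  also have "\<dots> = (\<Sum>y\<in>?S. 2 ^ N)"
    by (subst sum.inter_filter[symmetric]) auto
  also have "\<dots> = real (card ?S) * 2 ^ N" by simp
  also have "\<dots> \<le> 16 * 2 ^ N"
    using card_band_solutions_le[OF c N(2), of k] by (intro mult_right_mono) auto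
  finally show ?thesis .
qed

section \<open>Walsh characters linking consecutive levels\<close>

type_synonym grp = "nat set \<times> nat set \<times> nat set"

text \<open>
  Subsets form a group under symmetric difference, so \<open>grp n\<close> is a group of order \<open>8 * 4 ^ n\<close>
  and the functions \<open>walsh s t r\<close> for sign vectors \<open>s\<close>, \<open>t\<close>, \<open>r\<close> are its characters.
\<close>

definition grp :: "nat \<Rightarrow> grp set" where
  "grp n = Pow {..<n} \<times> Pow {..<n} \<times> Pow {..<3}"

fun walsh :: "(nat \<Rightarrow> real) \<Rightarrow> (nat \<Rightarrow> real) \<Rightarrow> (nat \<Rightarrow> real) \<Rightarrow> grp \<Rightarrow> real" where
  "walsh s t r (a, b, c) = prod s a * prod t b * prod r c"

lemma finite_grp [simp]: "finite (grp n)"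
  by (simp add: grp_def)

lemma card_grp: "card (grp n) = 8 * 4 ^ n"
proof -
  have "(2::nat) ^ n * 2 ^ n = 4 ^ n" by (simp flip: power_mult_distrib)
  then show ?thesis by (simp add: grp_def card_cartesian_product card_Pow)
qed

lemma walsh_orthogonal:
  assumes "\<And>i. s i * s i = 1" "\<And>i. t i * t i = 1" "\<And>i. r i * r i = 1"
    and "\<And>i. s' i * s' i = 1" "\<And>i. t' i * t' i = 1" "\<And>i. r' i * r' i = 1"
  shows "(\<Sum>g\<in>grp n. walsh s t r g * walsh s' t' r' g) =
    (if (\<forall>i<n. s i = s' i) \<and> (\<forall>i<n. t i = t' i) \<and> (\<forall>u<3. r u = r' u) then 8 * 4 ^ n else 0)"
proof -
  have eq1: "f i * f' i = 1 \<longleftrightarrow> f i = f' i" if "f i * f i = 1" "f' i * f' i = 1"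
    for f f' :: "nat \<Rightarrow> real" and i
    using that by (auto elim!: sign_cases)
  have one: "(\<Sum>a\<in>Pow {..<m}. \<Prod>i\<in>a. f i * f' i) = (if \<forall>i<m. f i = f' i then 2 ^ m else 0)"
    if "\<And>i. f i * f i = 1" "\<And>i. f' i * f' i = 1" for f f' :: "nat \<Rightarrow> real" and m :: nat
  proof -
    have "(f i * f' i) * (f i * f' i) = 1" for i
      using that[of i] by (simp add: algebra_simps)
    moreover have "f i * f' i = 1 \<longleftrightarrow> f i = f' i" for i
      using eq1[of f i f'] that by blast
    ultimately show ?thesis
      using sum_Pow_sign[of "{..<m}" "\<lambda>i. f i * f' i"] by (auto simp: Ball_def)
  qed
  have "(\<Sum>g\<in>grp n. walsh s t r g * walsh s' t' r' g) =
      (\<Sum>a\<in>Pow {..<n}. \<Sum>b\<in>Pow {..<n}. \<Sum>c\<in>Pow {..<3}.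
        (\<Prod>i\<in>a. s i * s' i) * ((\<Prod>i\<in>b. t i * t' i) * (\<Prod>i\<in>c. r i * r' i)))"
    unfolding grp_def sum.cartesian_product
    by (intro sum.cong) (auto simp: prod.distrib algebra_simps)
  also have "\<dots> = (\<Sum>a\<in>Pow {..<n}. \<Prod>i\<in>a. s i * s' i) *
      ((\<Sum>b\<in>Pow {..<n}. \<Prod>i\<in>b. t i * t' i) * (\<Sum>c\<in>Pow {..<3}. \<Prod>i\<in>c. r i * r' i))"
    by (simp only: sum_distrib_left[symmetric] sum_distrib_right[symmetric])
  also have "\<dots> = (if (\<forall>i<n. s i = s' i) \<and> (\<forall>i<n. t i = t' i) \<and> (\<forall>u<3. r u = r' u)
      then 2 ^ n * (2 ^ n * 2 ^ 3) else 0)"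
    using assms by (simp add: one)
  also have "(2::real) ^ n * (2 ^ n * 2 ^ 3) = 8 * 4 ^ n"
    by (simp add: power_mult_distrib[symmetric])
  finally show ?thesis .
qed

text \<open>
  The sign \<open>(- 1) ^ b\<close> for the bilinear form \<open>b\<close> that counts the \<open>i \<in> x\<close> with \<open>i + u \<in> y\<close>. A
  nonempty combination of these forms for distinct small offsets \<open>u\<close> is given by a band
  matrix, and so has almost full rank.
\<close>

definition band :: "nat \<Rightarrow> nat set \<Rightarrow> nat set \<Rightarrow> real" where
  "band u x y = (\<Prod>i\<in>x. sign_of (i + u \<in> y))"

text \<open>
  The labels of the larger character set of level \<open>n\<close> are pairs of subsets of \<open>{..<Suc n}\<close>. In
  the first two components of \<open>grp n\<close> only their elements below \<open>n\<close> are visible. The signs at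
  0 and 1, used in the third component, record whether \<open>n\<close> belongs to \<open>y\<close> and to \<open>x\<close>. The
  constant sign \<open>- 1\<close> keeps the larger set disjoint from the smaller one.
\<close>

definition twist :: "nat \<Rightarrow> nat set \<Rightarrow> nat set \<Rightarrow> nat \<Rightarrow> real" where
  "twist n x y u = (if u = 0 then sign_of (n \<in> y) else if u = 1 then sign_of (n \<in> x) else - 1)"

text \<open>
  A label \<open>(x, y)\<close> of level \<open>N\<close>, that is, a pair of subsets of \<open>{..<N}\<close>, defines a character
  of \<open>grp N\<close> and, if \<open>N = Suc n\<close>, up to sign a character of \<open>grp n\<close>. Both are graph points of
  the forms with offsets 0, 1 and 2. The form with offset 3 only contributes a sign that is
  constant on \<open>grp n\<close>; its purpose is to make the two characters of a label nearly
  uncorrelated as the label varies.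
\<close>

definition upper_char :: "nat set \<Rightarrow> nat set \<Rightarrow> grp \<Rightarrow> real" where
  "upper_char x y = walsh (\<lambda>i. sign_of (i \<in> x)) (\<lambda>i. sign_of (i \<in> y)) (\<lambda>u. band u x y)"

definition lower_char :: "nat \<Rightarrow> nat set \<Rightarrow> nat set \<Rightarrow> grp \<Rightarrow> real" where
  "lower_char n x y g = band 3 (x \<inter> {..<n}) y *
    walsh (\<lambda>i. sign_of (i \<in> x)) (\<lambda>i. sign_of (i \<in> y)) (\<lambda>u. twist n x y u * band u (x \<inter> {..<n}) y) g"

lemma band_square [simp]: "band u x y * band u x y = 1"
  unfolding band_def by (rule prod_sign) simp

lemma twist_square [simp]: "twist n x y u * twist n x y u = 1"
  by (simp add: twist_def)

lemma twist_band_square [simp]: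
  "(twist n x y u * band u x' y') * (twist n x y u * band u x' y') = 1"
  by (metis band_square mult.assoc mult.commute mult.right_neutral twist_square)

lemma subset_lessThan_eqI:
  fixes x x' :: "nat set"
  assumes "\<forall>i<n. i \<in> x \<longleftrightarrow> i \<in> x'" "x \<subseteq> {..<n}" "x' \<subseteq> {..<n}"
  shows "x = x'"
  using assms by blast

lemma less_3_iff: "(\<forall>u<3. P u) \<longleftrightarrow> P 0 \<and> P 1 \<and> P (2::nat)"
  by (auto simp: less_Suc_eq numeral_3_eq_3 numeral_2_eq_2)

lemma band_cong:
  assumes "x \<subseteq> {..<n}" "\<And>j. j < n + u \<Longrightarrow> j \<in> y \<longleftrightarrow> j \<in> y'"
  shows "band u x y = band u x y'"
  unfolding band_def using assms by (intro prod.cong refl) auto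

lemma band_mult_cancel: "band u x y * r = band u x y * r' \<longleftrightarrow> r = r'"
  by (metis band_square mult.assoc mult_1)

lemma upper_upper:
  assumes "x \<subseteq> {..<n}" "y \<subseteq> {..<n}" "x' \<subseteq> {..<n}" "y' \<subseteq> {..<n}"
  shows "(\<Sum>g\<in>grp n. upper_char x y g * upper_char x' y' g) = (if x = x' \<and> y = y' then 8 * 4 ^ n else 0)"
  using subset_lessThan_eqI[OF _ assms(1,3)] subset_lessThan_eqI[OF _ assms(2,4)]
  unfolding upper_char_def by (subst walsh_orthogonal) auto

text \<open>
  Distinct labels give distinct characters. The offsets in \<open>twist\<close> are assigned so that the
  label can be recovered: the elements below \<open>n\<close> are visible; the form with offset 0 does not
  involve whether \<open>n \<in> y\<close>, so that component reveals it; once \<open>y\<close> is known, component 1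
  reveals whether \<open>n \<in> x\<close>.
\<close>

lemma lower_lower:
  assumes "x \<subseteq> {..<Suc n}" "y \<subseteq> {..<Suc n}" "x' \<subseteq> {..<Suc n}" "y' \<subseteq> {..<Suc n}"
  shows "(\<Sum>g\<in>grp n. lower_char n x y g * lower_char n x' y' g) = (if x = x' \<and> y = y' then 8 * 4 ^ n else 0)"
proof -
  let ?b = "\<lambda>u x y. band u (x \<inter> {..<n}) y"
  let ?r = "\<lambda>x y u. twist n x y u * ?b u x y"
  let ?C = "(\<forall>i<n. sign_of (i \<in> x) = sign_of (i \<in> x')) \<and> (\<forall>i<n. sign_of (i \<in> y) = sign_of (i \<in> y'))
    \<and> (\<forall>u<3. ?r x y u = ?r x' y' u)"
  have "(\<Sum>g\<in>grp n. lower_char n x y g * lower_char n x' y' g) = (?b 3 x y * ?b 3 x' y') * (if ?C then 8 * 4 ^ n else 0)"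
    unfolding lower_char_def
    by (subst walsh_orthogonal[symmetric]) (simp_all add: sum_distrib_left algebra_simps)
  moreover have "x = x' \<and> y = y'" if C: ?C
  proof -
    have xn: "x \<inter> {..<n} = x' \<inter> {..<n}" using C by auto
    have y: "\<forall>i<n. i \<in> y \<longleftrightarrow> i \<in> y'" using C by auto
    have r: "?r x y 0 = ?r x' y' 0" "?r x y 1 = ?r x' y' 1"
      using C unfolding less_3_iff by blast+
    have "?b 0 x y = ?b 0 x' y'"
      unfolding xn using y by (intro band_cong[of _ n]) auto
    then have "n \<in> y \<longleftrightarrow> n \<in> y'"
      using r(1) band_mult_cancel[of 0 "x \<inter> {..<n}" y] by (auto simp: twist_def mult.commute)
    then have yy: "y = y'"
      using y assms by (intro subset_lessThan_eqI[of "Suc n"]) (auto simp: less_Suc_eq)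
    have "n \<in> x \<longleftrightarrow> n \<in> x'"
      using r(2) band_mult_cancel[of 1 "x \<inter> {..<n}" y] by (auto simp: twist_def mult.commute xn yy)
    then have "x = x'"
      using C assms by (intro subset_lessThan_eqI[of "Suc n"]) (auto simp: less_Suc_eq)
    then show ?thesis using yy by simp
  qed
  ultimately show ?thesis by auto
qed

text \<open>
  If the two characters agreed, component 0 would show \<open>n \<notin> y'\<close>; then \<open>y = y'\<close>, and component
  2 would equate a sign with its negative.
\<close>

lemma upper_lower:
  assumes "x \<subseteq> {..<n}" "y \<subseteq> {..<n}" "x' \<subseteq> {..<Suc n}" "y' \<subseteq> {..<Suc n}"
  shows "(\<Sum>g\<in>grp n. upper_char x y g * lower_char n x' y' g) = 0"
proof -
  let ?b = "\<lambda>u. band u (x' \<inter> {..<n}) y'"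
  let ?C = "(\<forall>i<n. sign_of (i \<in> x) = sign_of (i \<in> x')) \<and> (\<forall>i<n. sign_of (i \<in> y) = sign_of (i \<in> y'))
    \<and> (\<forall>u<3. band u x y = twist n x' y' u * ?b u)"
  have "(\<Sum>g\<in>grp n. upper_char x y g * lower_char n x' y' g) = ?b 3 * (if ?C then 8 * 4 ^ n else 0)"
    unfolding lower_char_def upper_char_def
    by (subst walsh_orthogonal[symmetric]) (simp_all add: sum_distrib_left algebra_simps)
  moreover have False if C: ?C
  proof -
    have x: "x' \<inter> {..<n} = x" using C assms by auto
    have y: "\<forall>i<n. i \<in> y \<longleftrightarrow> i \<in> y'" using C by auto
    have r: "band 0 x y = twist n x' y' 0 * ?b 0" "band 2 x y = twist n x' y' 2 * ?b 2"
      using C unfolding less_3_iff by blast+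
    have "band 0 x y = ?b 0"
      unfolding x using y assms by (intro band_cong[of _ n]) auto
    then have "n \<notin> y'"
      using r(1) band_square[of 0 x y] by (auto simp: twist_def sign_of_def simp del: band_square split: if_splits)
    then have "y = y'"
      using y assms by (intro subset_lessThan_eqI[of "Suc n"]) (auto simp: less_Suc_eq)
    then show False
      using r(2) band_square[of 2 x y] by (auto simp: twist_def x simp del: band_square)
  qed
  ultimately show ?thesis by auto
qed

text \<open>
  With \<open>y\<close> fixed, the character is a product over \<open>x\<close>, as the summation bound \<open>band_sum_le\<close>
  requires. The same is done for the lower characters below.
\<close>

lemma upper_prod:
  assumes "finite x" "finite a"
  shows "upper_char x y (a, b, c) =
    (\<Prod>i\<in>b. sign_of (i \<in> y)) * (\<Prod>i\<in>x. sign_of (i \<in> a) * (\<Prod>u\<in>c. sign_of (i + u \<in> y)))"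
  using prod_mem_flip[OF assms(2,1)]
  by (simp add: upper_char_def band_def prod.distrib prod.swap[of _ c x])

text \<open>
  The factors of the product form of a lower character: \<open>lower_sign\<close> collects what depends on
  an element \<open>i\<close> of \<open>x\<close>, and \<open>lower_weight\<close> the rest.
\<close>

definition lower_sign :: "nat \<Rightarrow> nat set \<Rightarrow> nat set \<Rightarrow> nat \<Rightarrow> nat set \<Rightarrow> real" where
  "lower_sign n a c i y = sign_of (i \<in> a) * (if i < n then \<Prod>u\<in>insert 3 c. sign_of (i + u \<in> y) else 1)
    * sign_of (i = n \<and> 1 \<in> c)"

definition lower_weight :: "nat \<Rightarrow> nat set \<Rightarrow> nat set \<Rightarrow> nat set \<Rightarrow> real" where
  "lower_weight n b c y = (\<Prod>i\<in>b. sign_of (i \<in> y)) * sign_of (0 \<in> c \<and> n \<in> y) * sign_of (2 \<in> c)"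

lemma lower_prod:
  assumes "finite x" "finite a" "c \<subseteq> {..<3}"
  shows "lower_char n x y (a, b, c) = lower_weight n b c y * (\<Prod>i\<in>x. lower_sign n a c i y)"
proof -
  let ?x = "x \<inter> {..<n}"
  have c: "finite c" "3 \<notin> c" using assms(3) by (auto intro: finite_subset)
  have "(\<Prod>u\<in>c. twist n x y u) = (\<Prod>u\<in>{..<3}. if u \<in> c then twist n x y u else 1)"
    using assms(3) by (intro prod.mono_neutral_cong_left) auto
  also have "\<dots> = sign_of (0 \<in> c \<and> n \<in> y) * sign_of (1 \<in> c \<and> n \<in> x) * sign_of (2 \<in> c)"
    by (simp add: numeral_3_eq_3 twist_def sign_of_def numeral_2_eq_2)
  finally have tw: "(\<Prod>u\<in>c. twist n x y u) = sign_of (0 \<in> c \<and> n \<in> y) * sign_of (1 \<in> c \<and> n \<in> x) * sign_of (2 \<in> c)" .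
  have n: "sign_of (1 \<in> c \<and> n \<in> x) = (\<Prod>i\<in>x. sign_of (i = n \<and> 1 \<in> c))"
  proof -
    have "(\<Prod>i\<in>x. sign_of (i = n \<and> 1 \<in> c)) = (\<Prod>i\<in>x. if i = n then sign_of (1 \<in> c) else 1)"
      by (intro prod.cong) (auto simp: sign_of_def)
    then show ?thesis using assms(1) by (simp add: prod.delta sign_of_def)
  qed
  have b: "band 3 ?x y * (\<Prod>u\<in>c. band u ?x y)
      = (\<Prod>i\<in>x. if i < n then \<Prod>u\<in>insert 3 c. sign_of (i + u \<in> y) else 1)"
  proof -
    have "band 3 ?x y * (\<Prod>u\<in>c. band u ?x y) = (\<Prod>u\<in>insert 3 c. band u ?x y)"
      using c by simp
    also have "\<dots> = (\<Prod>i\<in>?x. \<Prod>u\<in>insert 3 c. sign_of (i + u \<in> y))"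
      unfolding band_def by (rule prod.swap)
    also have "\<dots> = (\<Prod>i\<in>x. if i < n then \<Prod>u\<in>insert 3 c. sign_of (i + u \<in> y) else 1)"
      using assms(1) by (subst prod.inter_restrict) (auto intro: prod.cong)
    finally show ?thesis .
  qed
  have "lower_char n x y (a, b, c) = (\<Prod>i\<in>a. sign_of (i \<in> x)) * (\<Prod>i\<in>b. sign_of (i \<in> y)) *
      (\<Prod>u\<in>c. twist n x y u) * (band 3 ?x y * (\<Prod>u\<in>c. band u ?x y))"
    by (simp add: lower_char_def prod.distrib)
  also have "\<dots> = lower_weight n b c y * ((\<Prod>i\<in>x. sign_of (i \<in> a)) *
      (\<Prod>i\<in>x. if i < n then \<Prod>u\<in>insert 3 c. sign_of (i + u \<in> y) else 1) * (\<Prod>i\<in>x. sign_of (i = n \<and> 1 \<in> c)))"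
    unfolding tw n b prod_mem_flip[OF assms(2,1)] by (simp add: lower_weight_def)
  also have "\<dots> = lower_weight n b c y * (\<Prod>i\<in>x. lower_sign n a c i y)"
    by (simp add: lower_sign_def prod.distrib)
  finally show ?thesis .
qed

lemma abs_prod_sign_of [simp]: "\<bar>\<Prod>i\<in>A. sign_of (P i)\<bar> = 1"
  by (auto simp: abs_prod sign_of_def intro!: prod.neutral)

lemma prod_sign_of_square [simp]: "(\<Prod>i\<in>A. sign_of (P i)) * (\<Prod>i\<in>A. sign_of (P i)) = 1"
  by (rule prod_sign) simp

lemma lower_weight_abs [simp]: "\<bar>lower_weight n b c y\<bar> = 1"
  by (simp add: lower_weight_def abs_mult) (simp add: sign_of_def)

lemma sign_mult_square:
  fixes p q :: real
  assumes "p * p = 1" "q * q = 1"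
  shows "(p * q) * (p * q) = 1"
  using assms by (metis mult.assoc mult.commute mult.right_neutral)

lemma lower_sign_square [simp]: "lower_sign n a c i y * lower_sign n a c i y = 1"
  unfolding lower_sign_def by (intro sign_mult_square) auto

lemma separated_sum_eq_0:
  fixes N :: nat
  assumes "a \<subseteq> {..<N}" "b \<subseteq> {..<N}" "a' \<subseteq> {..<N}" "b' \<subseteq> {..<N}" "(a, b) \<noteq> (a', b')"
  shows "(\<Sum>x\<in>Pow {..<N}. \<Sum>y\<in>Pow {..<N}.
    (\<Prod>i\<in>y. sign_of (i \<in> b) * sign_of (i \<in> b')) * (\<Prod>i\<in>x. sign_of (i \<in> a) * sign_of (i \<in> a'))) = 0"
proof -
  let ?S = "\<lambda>a a'. \<Sum>x\<in>Pow {..<N}. \<Prod>i\<in>x. sign_of (i \<in> a) * sign_of (i \<in> a')"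
  have S: "?S a a' = 0" if sub: "a \<subseteq> {..<N}" "a' \<subseteq> {..<N}" and ne: "a \<noteq> a'" for a a'
  proof -
    have "\<not> (\<forall>i\<in>{..<N}. sign_of (i \<in> a) * sign_of (i \<in> a') = 1)"
      using sub ne subset_lessThan_eqI[of N a a'] by (auto simp: sign_of_def split: if_splits)
    moreover have "(sign_of (i \<in> a) * sign_of (i \<in> a')) * (sign_of (i \<in> a) * sign_of (i \<in> a')) = 1" for i
      by (intro sign_mult_square) auto
    ultimately show ?thesis
      by (subst sum_Pow_sign) auto
  qed
  have "(\<Sum>x\<in>Pow {..<N}. \<Sum>y\<in>Pow {..<N}.
    (\<Prod>i\<in>y. sign_of (i \<in> b) * sign_of (i \<in> b')) * (\<Prod>i\<in>x. sign_of (i \<in> a) * sign_of (i \<in> a'))) = ?S a a' * ?S b b'"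
    by (simp add: sum_product mult.commute)
  also have "\<dots> = 0"
    using assms S[of a a'] S[of b b'] by auto
  finally show ?thesis .
qed

text \<open>
  If the two points differ in the component \<open>c\<close>, a nontrivial combination of bilinear forms
  remains and \<open>band_sum_le\<close> applies. Otherwise the forms cancel, and the sum splits into
  complete character sums, one of which vanishes.
\<close>

lemma upper_correlation:
  assumes "g \<in> grp n" "h \<in> grp n" "g \<noteq> h"
  shows "\<bar>\<Sum>x\<in>Pow {..<n}. \<Sum>y\<in>Pow {..<n}. upper_char x y g * upper_char x y h\<bar> \<le> 16 * 2 ^ n"
proof -
  obtain a b c a' b' c' where gh: "g = (a, b, c)" "h = (a', b', c')"
    by (metis prod_cases3)
  have sub: "a \<subseteq> {..<n}" "b \<subseteq> {..<n}" "c \<subseteq> {..<3}" "a' \<subseteq> {..<n}" "b' \<subseteq> {..<n}" "c' \<subseteq> {..<3}"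
    using assms by (auto simp: grp_def gh)
  have fin: "finite a" "finite b" "finite c" "finite a'" "finite b'" "finite c'"
    using sub finite_subset by blast+
  let ?w = "\<lambda>y. (\<Prod>i\<in>b. sign_of (i \<in> y)) * (\<Prod>i\<in>b'. sign_of (i \<in> y))"
  let ?s = "\<lambda>i y. (sign_of (i \<in> a) * (\<Prod>u\<in>c. sign_of (i + u \<in> y))) * (sign_of (i \<in> a') * (\<Prod>u\<in>c'. sign_of (i + u \<in> y)))"
  let ?d = "c - c' \<union> (c' - c)"
  have eq: "(\<Sum>x\<in>Pow {..<n}. \<Sum>y\<in>Pow {..<n}. upper_char x y g * upper_char x y h)
      = (\<Sum>x\<in>Pow {..<n}. \<Sum>y\<in>Pow {..<n}. ?w y * (\<Prod>i\<in>x. ?s i y))"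
  proof (intro sum.cong refl)
    fix x y :: "nat set" assume "x \<in> Pow {..<n}"
    then have "finite x" using finite_subset by auto
    then show "upper_char x y g * upper_char x y h = ?w y * (\<Prod>i\<in>x. ?s i y)"
      using fin by (simp add: gh upper_prod prod.distrib algebra_simps)
  qed
  have s: "?s i y = sign_of (i \<in> a) * sign_of (i \<in> a') * (\<Prod>u\<in>?d. sign_of (i + u \<in> y))" for i y
    using prod_sign_mult[OF fin(3,6), of "\<lambda>u. sign_of (i + u \<in> y)"] by (simp add: algebra_simps)
  show ?thesis
  proof (cases "c = c'")
    case True
    have "(\<Sum>x\<in>Pow {..<n}. \<Sum>y\<in>Pow {..<n}. upper_char x y g * upper_char x y h) =
      (\<Sum>x\<in>Pow {..<n}. \<Sum>y\<in>Pow {..<n}.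
        (\<Prod>i\<in>y. sign_of (i \<in> b) * sign_of (i \<in> b')) * (\<Prod>i\<in>x. sign_of (i \<in> a) * sign_of (i \<in> a')))"
      unfolding eq s
    proof (intro sum.cong refl)
      fix x y :: "nat set" assume "y \<in> Pow {..<n}"
      then have "finite y" using finite_subset by auto
      then show "?w y * (\<Prod>i\<in>x. sign_of (i \<in> a) * sign_of (i \<in> a') * (\<Prod>u\<in>?d. sign_of (i + u \<in> y))) =
        (\<Prod>i\<in>y. sign_of (i \<in> b) * sign_of (i \<in> b')) * (\<Prod>i\<in>x. sign_of (i \<in> a) * sign_of (i \<in> a'))"
        using True fin by (simp add: prod.distrib prod_mem_flip)
    qed
    also have "\<dots> = 0"
      using separated_sum_eq_0[of a n b a' b'] sub assms(3) True by (auto simp: gh)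
    finally show ?thesis by simp
  next
    case False
    show ?thesis
      unfolding eq
    proof (rule band_sum_le[where n = n])
      show "?d \<subseteq> {..<4}" "?d \<noteq> {}" using sub False by auto
      show "\<bar>?w y\<bar> \<le> 1" for y by (simp add: abs_mult)
      show "?s i y * ?s i y = 1" for i y by (intro sign_mult_square) auto
      show "?s i y = (sign_of (i \<in> a) * sign_of (i \<in> a')) * (\<Prod>u\<in>?d. sign_of (i + u \<in> y))" for i y by (rule s)
    qed auto
  qed
qed

lemma lower_correlation:
  assumes "g \<in> grp n" "h \<in> grp n" "g \<noteq> h"
  shows "\<bar>\<Sum>x\<in>Pow {..<Suc n}. \<Sum>y\<in>Pow {..<Suc n}. lower_char n x y g * lower_char n x y h\<bar> \<le> 16 * 2 ^ Suc n"
proof -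
  obtain a b c a' b' c' where gh: "g = (a, b, c)" "h = (a', b', c')"
    by (metis prod_cases3)
  have sub: "a \<subseteq> {..<n}" "b \<subseteq> {..<n}" "c \<subseteq> {..<3}" "a' \<subseteq> {..<n}" "b' \<subseteq> {..<n}" "c' \<subseteq> {..<3}"
    using assms by (auto simp: grp_def gh)
  have fin: "finite a" "finite b" "finite c" "finite a'" "finite b'" "finite c'"
    using sub finite_subset by blast+
  let ?w = "\<lambda>y. lower_weight n b c y * lower_weight n b' c' y"
  let ?s = "\<lambda>i y. lower_sign n a c i y * lower_sign n a' c' i y"
  let ?d = "insert 3 c - insert 3 c' \<union> (insert 3 c' - insert 3 c)"
  have eq: "(\<Sum>x\<in>Pow {..<Suc n}. \<Sum>y\<in>Pow {..<Suc n}. lower_char n x y g * lower_char n x y h)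
      = (\<Sum>x\<in>Pow {..<Suc n}. \<Sum>y\<in>Pow {..<Suc n}. ?w y * (\<Prod>i\<in>x. ?s i y))"
  proof (intro sum.cong refl)
    fix x y :: "nat set" assume "x \<in> Pow {..<Suc n}"
    then have "finite x" using finite_subset by auto
    then show "lower_char n x y g * lower_char n x y h = ?w y * (\<Prod>i\<in>x. ?s i y)"
      using fin sub by (simp add: gh lower_prod prod.distrib algebra_simps)
  qed
  show ?thesis
  proof (cases "c = c'")
    case True
    have sq: "(p * r * q) * (p' * r * q) = p * p'" if "r * r = 1" "q * q = 1" for p p' q r :: real
      using that by (metis mult.assoc mult.commute mult.right_neutral)
    have s: "?s i y = sign_of (i \<in> a) * sign_of (i \<in> a')" for i y
      unfolding True lower_sign_def by (rule sq) auto
    have w: "?w y = (\<Prod>i\<in>b. sign_of (i \<in> y)) * (\<Prod>i\<in>b'. sign_of (i \<in> y))" for y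
      unfolding True lower_weight_def by (rule sq) auto
    have "(\<Sum>x\<in>Pow {..<Suc n}. \<Sum>y\<in>Pow {..<Suc n}. lower_char n x y g * lower_char n x y h) =
      (\<Sum>x\<in>Pow {..<Suc n}. \<Sum>y\<in>Pow {..<Suc n}.
        (\<Prod>i\<in>y. sign_of (i \<in> b) * sign_of (i \<in> b')) * (\<Prod>i\<in>x. sign_of (i \<in> a) * sign_of (i \<in> a')))"
      unfolding eq s w
    proof (intro sum.cong refl)
      fix x y :: "nat set" assume "y \<in> Pow {..<Suc n}"
      then have "finite y" using finite_subset by auto
      then show "(\<Prod>i\<in>b. sign_of (i \<in> y)) * (\<Prod>i\<in>b'. sign_of (i \<in> y)) * (\<Prod>i\<in>x. sign_of (i \<in> a) * sign_of (i \<in> a')) =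
        (\<Prod>i\<in>y. sign_of (i \<in> b) * sign_of (i \<in> b')) * (\<Prod>i\<in>x. sign_of (i \<in> a) * sign_of (i \<in> a'))"
        using fin by (simp add: prod.distrib prod_mem_flip)
    qed
    also have "\<dots> = 0"
      using sub assms(3) True by (intro separated_sum_eq_0) (auto simp: gh)
    finally show ?thesis by simp
  next
    case False
    show ?thesis
      unfolding eq
    proof (rule band_sum_le[where n = n])
      show "?d \<subseteq> {..<4}" "?d \<noteq> {}" using sub False by auto
      show "\<bar>?w y\<bar> \<le> 1" for y by (simp add: abs_mult)
      show "?s i y * ?s i y = 1" for i y by (intro sign_mult_square) auto
      show "?s i y = (sign_of (i \<in> a) * sign_of (i = n \<and> 1 \<in> c) * (sign_of (i \<in> a') * sign_of (i = n \<and> 1 \<in> c')))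
        * (\<Prod>u\<in>?d. sign_of (i + u \<in> y))" if "i < n" for i y
        using that fin by (subst prod_sign_mult[symmetric]) (auto simp: lower_sign_def algebra_simps)
    qed auto
  qed
qed

text \<open>
  Offset 3 occurs in the lower character only, so it survives in the product and the
  combination of forms is never trivial.
\<close>

lemma lower_upper_correlation:
  assumes "g \<in> grp n" "h \<in> grp (Suc n)"
  shows "\<bar>\<Sum>x\<in>Pow {..<Suc n}. \<Sum>y\<in>Pow {..<Suc n}. lower_char n x y g * upper_char x y h\<bar> \<le> 16 * 2 ^ Suc n"
proof -
  obtain a b c a' b' c' where gh: "g = (a, b, c)" "h = (a', b', c')"
    by (metis prod_cases3)
  have sub: "a \<subseteq> {..<n}" "b \<subseteq> {..<n}" "c \<subseteq> {..<3}"
      "a' \<subseteq> {..<Suc n}" "b' \<subseteq> {..<Suc n}" "c' \<subseteq> {..<3}"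
    using assms by (auto simp: grp_def gh)
  have fin: "finite a" "finite b" "finite c" "finite a'" "finite b'" "finite c'"
    using sub finite_subset by blast+
  let ?w = "\<lambda>y. lower_weight n b c y * (\<Prod>i\<in>b'. sign_of (i \<in> y))"
  let ?s = "\<lambda>i y. lower_sign n a c i y * (sign_of (i \<in> a') * (\<Prod>u\<in>c'. sign_of (i + u \<in> y)))"
  let ?d = "insert 3 c - c' \<union> (c' - insert 3 c)"
  have eq: "(\<Sum>x\<in>Pow {..<Suc n}. \<Sum>y\<in>Pow {..<Suc n}. lower_char n x y g * upper_char x y h)
      = (\<Sum>x\<in>Pow {..<Suc n}. \<Sum>y\<in>Pow {..<Suc n}. ?w y * (\<Prod>i\<in>x. ?s i y))"
  proof (intro sum.cong refl)
    fix x y :: "nat set" assume "x \<in> Pow {..<Suc n}"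
    then have "finite x" using finite_subset by auto
    then show "lower_char n x y g * upper_char x y h = ?w y * (\<Prod>i\<in>x. ?s i y)"
      using fin sub by (simp add: gh lower_prod upper_prod prod.distrib algebra_simps)
  qed
  show ?thesis
    unfolding eq
  proof (rule band_sum_le[where n = n])
    show "?d \<subseteq> {..<4}" "?d \<noteq> {}" using sub by auto
    show "\<bar>?w y\<bar> \<le> 1" for y by (simp add: abs_mult)
    show "?s i y * ?s i y = 1" for i y by (intro sign_mult_square) auto
    show "?s i y = (sign_of (i \<in> a) * sign_of (i = n \<and> 1 \<in> c) * sign_of (i \<in> a'))
      * (\<Prod>u\<in>?d. sign_of (i + u \<in> y))" if "i < n" for i y
      using that fin by (subst prod_sign_mult[symmetric]) (auto simp: lower_sign_def algebra_simps)
  qed auto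
qed

section \<open>A matrix with square zero and trace one\<close>

type_synonym idx = "nat \<times> grp"

definition idx_set :: "idx set" where
  "idx_set = (SIGMA n:UNIV. grp n)"

definition idx_upto :: "nat \<Rightarrow> idx set" where
  "idx_upto K = (SIGMA n:{..K}. grp n)"

text \<open>
  Every label of level \<open>N\<close> contributes a left vector and a right vector, both supported on the
  levels \<open>N\<close> and \<open>N - 1\<close>. The opposite signs in the right vector make the two levels cancel in
  scalar products.
\<close>

definition left_vec :: "nat \<Rightarrow> nat set \<Rightarrow> nat set \<Rightarrow> idx \<Rightarrow> real" where
  "left_vec N x y = (\<lambda>(m, g). if m = N then upper_char x y g else if Suc m = N then lower_char m x y g else 0)"

definition right_vec :: "nat \<Rightarrow> nat set \<Rightarrow> nat set \<Rightarrow> idx \<Rightarrow> real" where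
  "right_vec N x y = (\<lambda>(m, g). if m = N then - upper_char x y g / (8 * 4 ^ m)
    else if Suc m = N then lower_char m x y g / (8 * 4 ^ m) else 0)"

definition block :: "nat \<Rightarrow> idx \<Rightarrow> idx \<Rightarrow> real" where
  "block N p q =
    (\<Sum>x\<in>Pow {..<N}. \<Sum>y\<in>Pow {..<N}. left_vec N x y p * right_vec N x y q) / 4 ^ N"

text \<open>
  The sum of all blocks with \<open>N \<ge> 1\<close>; only \<open>N = fst p\<close> and \<open>N = Suc (fst p)\<close> contribute to row
  \<open>p\<close>.
\<close>

definition davie_matrix :: "idx \<Rightarrow> idx \<Rightarrow> real" where
  "davie_matrix p q = (\<Sum>N\<in>{1..Suc (fst p)}. block N p q)"

lemma finite_idx_upto [simp]: "finite (idx_upto K)"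
  by (simp add: idx_upto_def)

text \<open>
  For equal levels the scalar product is the difference of two equal orthogonality relations,
  one for each level of the support. For neighbouring levels the supports meet in one level,
  where upper characters are orthogonal to lower ones.
\<close>

lemma biorthogonal:
  assumes "N \<ge> 1" "M \<ge> 1" "N \<le> K"
    and sub: "x \<subseteq> {..<N}" "y \<subseteq> {..<N}" "x' \<subseteq> {..<M}" "y' \<subseteq> {..<M}"
  shows "(\<Sum>p\<in>idx_upto K. right_vec N x y p * left_vec M x' y' p) = 0"
proof -
  obtain n where n: "N = Suc n" using assms(1) by (cases N) auto
  define f where "f m = (\<Sum>g\<in>grp m. right_vec N x y (m, g) * left_vec M x' y' (m, g))" for m
  have f0: "f m = 0" if "m \<noteq> N" "Suc m \<noteq> N" for m
    using that by (simp add: f_def right_vec_def)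
  have "f n + f N = 0"
  proof -
    consider "M = N" | "M = Suc N" | "Suc M = N" | "M \<noteq> N" "M \<noteq> Suc N" "Suc M \<noteq> N" by blast
    then show ?thesis
    proof cases
      case 1
      have "f n = (if x = x' \<and> y = y' then 1 else 0)"
        using lower_lower[of x n y x' y'] sub 1
        by (simp add: f_def right_vec_def left_vec_def n sum_divide_distrib[symmetric])
      moreover have "f N = - (if x = x' \<and> y = y' then 1 else 0)"
        using upper_upper[of x N y x' y'] sub 1
        by (simp add: f_def right_vec_def left_vec_def sum_divide_distrib[symmetric] sum_negf)
      ultimately show ?thesis by simp
    next
      case 2
      have "f N = 0"
        using upper_lower[of x N y x' y'] sub 2
        by (simp add: f_def right_vec_def left_vec_def sum_divide_distrib[symmetric] sum_negf)
      moreover have "f n = 0" using 2 n by (simp add: f_def left_vec_def)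
      ultimately show ?thesis by simp
    next
      case 3
      then have M: "M = n" using n by simp
      have "f n = 0"
        using upper_lower[of x' n y' x y] sub 3 M n
        by (simp add: f_def right_vec_def left_vec_def sum_divide_distrib[symmetric] mult.commute)
      moreover have "f N = 0" using 3 n by (simp add: f_def left_vec_def)
      ultimately show ?thesis by simp
    next
      case 4
      then show ?thesis using n by (simp add: f_def left_vec_def)
    qed
  qed
  have "(\<Sum>p\<in>idx_upto K. right_vec N x y p * left_vec M x' y' p) = (\<Sum>m\<le>K. f m)"
    unfolding f_def idx_upto_def by (simp add: sum.Sigma)
  also have "\<dots> = (\<Sum>m\<in>{n, N}. f m)"
    using f0 n assms(3) by (intro sum.mono_neutral_right) auto
  also have "\<dots> = 0" using \<open>f n + f N = 0\<close> n by simp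
  finally show ?thesis .
qed

lemma block_eq_0: "N \<noteq> fst p \<Longrightarrow> N \<noteq> Suc (fst p) \<Longrightarrow> block N p q = 0"
  "N \<noteq> fst q \<Longrightarrow> N \<noteq> Suc (fst q) \<Longrightarrow> block N p q = 0"
  by (auto simp: block_def left_vec_def right_vec_def case_prod_beta)

lemma davie_matrix_eq_sum:
  assumes "fst p < K"
  shows "davie_matrix p q = (\<Sum>N\<in>{1..K}. block N p q)"
  unfolding davie_matrix_def using assms by (intro sum.mono_neutral_left) (auto intro!: block_eq_0(1))

lemma davie_matrix_eq_0:
  assumes "fst q > Suc (fst p)"
  shows "davie_matrix p q = 0"
  unfolding davie_matrix_def using assms by (intro sum.neutral) (auto intro!: block_eq_0(2))

lemma block_mult:
  assumes "N \<ge> 1" "M \<ge> 1" "N \<le> K"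
  shows "(\<Sum>h\<in>idx_upto K. block N p h * block M h q) = 0"
proof -
  let ?P = "\<lambda>N::nat. Pow {..<N} \<times> Pow {..<N}"
  have b: "block N p q = (\<Sum>z\<in>?P N. left_vec N (fst z) (snd z) p * right_vec N (fst z) (snd z) q) / 4 ^ N"
    for N p q
    by (simp add: block_def sum.cartesian_product case_prod_beta)
  have "(\<Sum>h\<in>idx_upto K. block N p h * block M h q) =
    (\<Sum>h\<in>idx_upto K. \<Sum>z\<in>?P N. \<Sum>w\<in>?P M.
      (left_vec N (fst z) (snd z) p * right_vec M (fst w) (snd w) q) / (4 ^ N * 4 ^ M) *
      (right_vec N (fst z) (snd z) h * left_vec M (fst w) (snd w) h))"
    unfolding b times_divide_times_eq sum_product sum_divide_distrib
    by (intro sum.cong refl) simp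
  also have "\<dots> = (\<Sum>z\<in>?P N. \<Sum>w\<in>?P M.
      (left_vec N (fst z) (snd z) p * right_vec M (fst w) (snd w) q) / (4 ^ N * 4 ^ M) *
      (\<Sum>h\<in>idx_upto K. right_vec N (fst z) (snd z) h * left_vec M (fst w) (snd w) h))"
    unfolding sum_distrib_left
    by (subst sum.swap, intro sum.cong refl, subst sum.swap, intro sum.cong refl)
  also have "\<dots> = 0"
    using biorthogonal[OF assms] by (intro sum.neutral ballI) auto
  finally show ?thesis .
qed

lemma davie_matrix_square:
  assumes "Suc (fst p) < K"
  shows "(\<Sum>h\<in>idx_upto K. davie_matrix p h * davie_matrix h q) = 0"
proof -
  have "(\<Sum>h\<in>idx_upto K. davie_matrix p h * davie_matrix h q) =
    (\<Sum>h\<in>idx_upto K. \<Sum>N\<in>{1..Suc (fst p)}. \<Sum>M\<in>{1..Suc K}. block N p h * block M h q)"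
  proof (rule sum.cong)
    fix h assume "h \<in> idx_upto K"
    then have "fst h < Suc K" by (auto simp: idx_upto_def)
    then show "davie_matrix p h * davie_matrix h q =
      (\<Sum>N\<in>{1..Suc (fst p)}. \<Sum>M\<in>{1..Suc K}. block N p h * block M h q)"
      unfolding davie_matrix_eq_sum[OF \<open>fst h < Suc K\<close>] davie_matrix_def[of p] by (simp only: sum_product)
  qed simp
  also have "\<dots> = (\<Sum>N\<in>{1..Suc (fst p)}. \<Sum>M\<in>{1..Suc K}. \<Sum>h\<in>idx_upto K. block N p h * block M h q)"
    by (subst sum.swap, intro sum.cong refl, subst sum.swap, intro sum.cong refl)
  also have "\<dots> = 0"
    using assms by (intro sum.neutral ballI block_mult) auto
  finally show ?thesis .
qed

lemma upper_square:
  assumes "x \<subseteq> {..<n}" "g \<in> grp n"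
  shows "upper_char x y g * upper_char x y g = 1"
proof -
  obtain a b c where g: "g = (a, b, c)" by (metis prod_cases3)
  have "finite x" "finite a" using assms g by (auto simp: grp_def intro: finite_subset)
  then show ?thesis
    unfolding g upper_prod[OF \<open>finite x\<close> \<open>finite a\<close>]
    by (intro sign_mult_square prod_sign) auto
qed

lemma lower_square:
  assumes "x \<subseteq> {..<Suc n}" "g \<in> grp n"
  shows "lower_char n x y g * lower_char n x y g = 1"
proof -
  obtain a b c where g: "g = (a, b, c)" by (metis prod_cases3)
  have "finite x" "finite a" "c \<subseteq> {..<3}" using assms g by (auto simp: grp_def intro: finite_subset)
  then show ?thesis
    unfolding g lower_prod[OF \<open>finite x\<close> \<open>finite a\<close> \<open>c \<subseteq> {..<3}\<close>] lower_weight_def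
    by (intro sign_mult_square prod_sign) auto
qed

lemma sum_Pow_const: "(\<Sum>x\<in>Pow {..<N::nat}. \<Sum>y\<in>Pow {..<N}. r) = 4 ^ N * (r::real)"
proof -
  have "(2::real) ^ N * 2 ^ N = 4 ^ N" by (simp flip: power_mult_distrib)
  then show ?thesis by (simp add: card_Pow mult.assoc[symmetric])
qed

lemma block_upper_upper:
  "block m (m, g) (m, h) = - (\<Sum>x\<in>Pow {..<m}. \<Sum>y\<in>Pow {..<m}. upper_char x y g * upper_char x y h) / (8 * 4 ^ m * 4 ^ m)"
  by (simp add: block_def left_vec_def right_vec_def sum_negf flip: sum_divide_distrib)

lemma block_lower_lower:
  "block (Suc m) (m, g) (m, h) =
    (\<Sum>x\<in>Pow {..<Suc m}. \<Sum>y\<in>Pow {..<Suc m}. lower_char m x y g * lower_char m x y h) / (8 * 4 ^ m * 4 ^ Suc m)"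
  by (simp add: block_def left_vec_def right_vec_def flip: sum_divide_distrib)

lemma block_lower_upper:
  "block (Suc m) (m, g) (Suc m, h) =
    - (\<Sum>x\<in>Pow {..<Suc m}. \<Sum>y\<in>Pow {..<Suc m}. lower_char m x y g * upper_char x y h) / (8 * 4 ^ Suc m * 4 ^ Suc m)"
  by (simp add: block_def left_vec_def right_vec_def sum_negf flip: sum_divide_distrib)

lemma block_upper_lower:
  "block (Suc k) (Suc k, g) (k, h) =
    (\<Sum>x\<in>Pow {..<Suc k}. \<Sum>y\<in>Pow {..<Suc k}. lower_char k x y h * upper_char x y g) / (8 * 4 ^ k * 4 ^ Suc k)"
  by (simp add: block_def left_vec_def right_vec_def mult.commute flip: sum_divide_distrib)

lemma davie_matrix_eq: "davie_matrix p q = (if fst p = 0 then 0 else block (fst p) p q) + block (Suc (fst p)) p q"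
proof -
  have "davie_matrix p q = (\<Sum>N\<in>{fst p, Suc (fst p)} \<inter> {1..}. block N p q)"
    unfolding davie_matrix_def by (intro sum.mono_neutral_right) (auto intro!: block_eq_0(1))
  also have "{fst p, Suc (fst p)} \<inter> {1..} = (if fst p = 0 then {1} else {fst p, Suc (fst p)})"
    by auto
  finally show ?thesis by (auto split: if_splits)
qed

text \<open>
  All characters have square 1, so on the diagonal the two blocks meeting at a level
  contribute \<open>1 / (8 * 4 ^ m)\<close> with opposite signs. On level 0 there is only one block.
\<close>

lemma davie_matrix_diag:
  assumes "p \<in> idx_set"
  shows "davie_matrix p p = (if fst p = 0 then 1 / 8 else 0)"
proof -
  obtain m g where p: "p = (m, g)" "g \<in> grp m" using assms by (auto simp: idx_set_def)
  have "(\<Sum>x\<in>Pow {..<m}. \<Sum>y\<in>Pow {..<m}. upper_char x y g * upper_char x y g)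
      = (\<Sum>x\<in>Pow {..<m}. \<Sum>y\<in>Pow {..<m}. 1)"
    using p(2) by (intro sum.cong refl upper_square) auto
  then have upper_char: "block m (m, g) (m, g) = - 1 / (8 * 4 ^ m)"
    by (simp only: block_upper_upper sum_Pow_const) simp
  have "(\<Sum>x\<in>Pow {..<Suc m}. \<Sum>y\<in>Pow {..<Suc m}. lower_char m x y g * lower_char m x y g)
      = (\<Sum>x\<in>Pow {..<Suc m}. \<Sum>y\<in>Pow {..<Suc m}. 1)"
    using p(2) by (intro sum.cong refl lower_square) auto
  then have "block (Suc m) (m, g) (m, g) = 1 / (8 * 4 ^ m)"
    by (simp only: block_lower_lower sum_Pow_const) simp
  then show ?thesis using upper_char by (simp add: davie_matrix_eq p)
qed

lemma divide_powers:
  "16 * 2 ^ m / (8 * 4 ^ m * 4 ^ m) = 2 / (8::real) ^ m"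
proof -
  have "(4::real) ^ m * 4 ^ m = 8 ^ m * 2 ^ m" by (simp flip: power_mult_distrib)
  then show ?thesis by (simp add: divide_simps)
qed

text \<open>
  Each entry off the diagonal is a normalisation of order \<open>1 / 4 ^ m\<close> times an average of
  signs over \<open>4 ^ m\<close> labels, and the correlation bounds make that average at most of order
  \<open>1 / 2 ^ m\<close>.
\<close>

lemma abs_davie_matrix_le:
  assumes "p \<in> idx_set" "q \<in> idx_set"
  shows "\<bar>davie_matrix p q\<bar> \<le> 8 / 8 ^ fst p"
proof -
  obtain m g k h where p: "p = (m, g)" "g \<in> grp m" and q: "q = (k, h)" "h \<in> grp k"
    using assms by (auto simp: idx_set_def)
  consider "k = m" "g = h" | "k = m" "g \<noteq> h" | "k = Suc m" | "m = Suc k"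
    | "k \<noteq> m" "k \<noteq> Suc m" "m \<noteq> Suc k" by blast
  then show ?thesis
  proof cases
    case 1
    then have "p = q" using p q by simp
    then show ?thesis using davie_matrix_diag[OF assms(1)] by simp
  next
    case 2
    have "\<bar>block m p q\<bar> \<le> 16 * 2 ^ m / (8 * 4 ^ m * 4 ^ m)"
      unfolding p(1) q(1) 2(1) block_upper_upper abs_divide abs_minus_cancel
      using upper_correlation[of g m h] 2 p q by (intro frac_le) auto
    then have "\<bar>block m p q\<bar> \<le> 2 / 8 ^ m" by (simp only: divide_powers)
    moreover have "\<bar>block (Suc m) p q\<bar> \<le> 16 * 2 ^ Suc m / (8 * 4 ^ m * 4 ^ Suc m)"
      unfolding p(1) q(1) 2(1) block_lower_lower abs_divide
      using lower_correlation[of g m h] 2 p q by (intro frac_le) auto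
    then have "\<bar>block (Suc m) p q\<bar> \<le> 16 * 2 ^ m / (8 * 4 ^ m * 4 ^ m) / 2"
      by simp
    then have "\<bar>block (Suc m) p q\<bar> \<le> 1 / 8 ^ m" by (simp only: divide_powers) simp
    moreover have "2 / 8 ^ m + 1 / 8 ^ m \<le> 8 / (8::real) ^ m" by (simp add: divide_simps)
    moreover have "\<bar>davie_matrix p q\<bar> \<le> \<bar>block m p q\<bar> + \<bar>block (Suc m) p q\<bar>"
      unfolding davie_matrix_eq using abs_triangle_ineq[of "block m p q"] by (auto simp: p(1))
    ultimately show ?thesis by (simp add: p(1))
  next
    case 3
    have "block m p q = 0" using 3 by (intro block_eq_0) (auto simp: q)
    then have "davie_matrix p q = block (Suc m) p q" by (simp add: davie_matrix_eq p(1))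
    moreover have "\<bar>block (Suc m) p q\<bar> \<le> 16 * 2 ^ Suc m / (8 * 4 ^ Suc m * 4 ^ Suc m)"
      unfolding p(1) q(1) 3 block_lower_upper abs_divide abs_minus_cancel
      using lower_upper_correlation[of g m h] 3 p q by (intro frac_le) auto
    moreover have "2 / 8 ^ Suc m \<le> 8 / (8::real) ^ m" by (simp add: divide_simps)
    ultimately show ?thesis by (simp only: divide_powers p(1) fst_conv)
  next
    case 4
    have "block (Suc m) p q = 0" using 4 by (intro block_eq_0) (auto simp: q)
    then have "davie_matrix p q = block m p q" by (simp add: davie_matrix_eq p(1) 4)
    moreover have "\<bar>block m p q\<bar> \<le> 16 * 2 ^ Suc k / (8 * 4 ^ k * 4 ^ Suc k)"
      unfolding p(1) q(1) 4 block_upper_lower abs_divide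
      using lower_upper_correlation[of h k g] 4 p q by (intro frac_le) auto
    then have "\<bar>block m p q\<bar> \<le> 4 * (16 * 2 ^ Suc k / (8 * 4 ^ Suc k * 4 ^ Suc k))"
      by simp
    then have "\<bar>block m p q\<bar> \<le> 8 / 8 ^ m" by (simp only: divide_powers 4)
    ultimately show ?thesis by (simp add: p(1))
  next
    case 5
    have "block m p q = 0" using 5 by (intro block_eq_0(2)) (auto simp: q)
    moreover have "block (Suc m) p q = 0" using 5 by (intro block_eq_0(2)) (auto simp: q)
    ultimately show ?thesis by (simp add: davie_matrix_eq p(1))
  qed
qed

text \<open>
  Level \<open>m\<close> has \<open>8 * 4 ^ m\<close> rows of size \<open>8 / 8 ^ m\<close>, so there is room for weights that
  decrease geometrically, such as \<open>(2 / 3) ^ m\<close>. The index set is enumerated by the natural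
  numbers.
\<close>

lemma exists_square_zero_matrix:
  obtains a :: "nat \<Rightarrow> nat \<Rightarrow> real" and \<kappa> l :: "nat \<Rightarrow> real" where "square_zero_matrix a \<kappa> l"
proof -
  define e where "e = from_nat_into idx_set"
  have "infinite idx_set"
  proof
    assume "finite idx_set"
    then have "finite (fst ` idx_set)" by simp
    moreover have "fst ` idx_set = UNIV"
      by (force simp: idx_set_def grp_def image_iff)
    ultimately show False by simp
  qed
  moreover have "countable idx_set"
    unfolding idx_set_def by (intro countable_SIGMA) (auto intro: countable_finite)
  ultimately have e: "bij_betw e UNIV idx_set"
    unfolding e_def by (intro bij_betw_from_nat_into)
  have e_in: "e i \<in> idx_set" for i using e by (auto simp: bij_betw_def)
  have inj: "inj e" using e by (simp add: bij_betw_def)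
  define lev where "lev i = fst (e i)" for i
  define F where "F K = {i. lev i \<le> K}" for K
  have F_eq: "F K = e -` idx_upto K" for K
  proof -
    have "lev i \<le> K \<longleftrightarrow> e i \<in> idx_upto K" for i
      using e_in[of i] by (cases "e i") (simp add: lev_def idx_upto_def idx_set_def)
    then show ?thesis by (simp add: F_def vimage_def)
  qed
  have fin: "finite (F K)" for K
    unfolding F_eq using inj by (intro finite_vimageI) auto
  have "idx_upto K \<subseteq> range e" for K
    using e by (auto simp: bij_betw_def idx_upto_def idx_set_def)
  then have bij: "bij_betw e (F K) (idx_upto K)" for K
    unfolding F_eq bij_betw_def using inj_on_subset[OF inj] by (simp add: image_vimage_eq Int_absorb2)
  have reindex: "(\<Sum>i\<in>F K. f (e i)) = (\<Sum>p\<in>idx_upto K. f p)" for f :: "idx \<Rightarrow> real" and K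
    using bij by (rule sum.reindex_bij_betw)
  define a where "a i j = davie_matrix (e i) (e j)" for i j
  define l where "l i = 8 / (8::real) ^ lev i" for i
  define \<kappa> where "\<kappa> i = (2 / 3 :: real) ^ lev i" for i
  show thesis
  proof (rule that, unfold_locales)
    show "\<bar>a i j\<bar> \<le> l i" for i j
      unfolding a_def l_def lev_def using e_in by (intro abs_davie_matrix_le)
    have a0: "a i j = 0" if "j \<notin> F (Suc (lev i))" for i j
      using that unfolding a_def by (intro davie_matrix_eq_0) (auto simp: F_def lev_def)
    have "eventually (\<lambda>j. j \<notin> F K) sequentially" for K
      using fin[of K] by (simp add: cofinite_eq_sequentially[symmetric] eventually_cofinite)
    note ev = this
    show "a i \<longlonglongrightarrow> 0" for i
      using ev[of "Suc (lev i)"] a0 by (intro tendsto_eventually) (auto elim!: eventually_mono)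
    show "0 < \<kappa> i" "\<kappa> i \<le> 1" for i
      by (auto simp: \<kappa>_def intro: power_le_one)
    have "filterlim lev at_top sequentially"
      unfolding filterlim_at_top
      using ev by (metis (mono_tags, lifting) F_def eventually_mono linorder_le_cases mem_Collect_eq)
    then show "\<kappa> \<longlonglongrightarrow> 0"
      unfolding \<kappa>_def by (rule filterlim_compose[OF LIMSEQ_realpow_zero, rotated -1]) auto
    show "summable (\<lambda>i. l i / \<kappa> i)"
    proof (rule summableI_nonneg_bounded)
      show "0 \<le> l i / \<kappa> i" for i by (simp add: l_def \<kappa>_def)
      fix n
      define K where "K = Max (insert 0 (lev ` {..<n}))"
      have "{..<n} \<subseteq> F K" by (auto simp: F_def K_def)
      then have "(\<Sum>i<n. l i / \<kappa> i) \<le> (\<Sum>i\<in>F K. l i / \<kappa> i)"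
        using fin by (intro sum_mono2) (auto simp: l_def \<kappa>_def)
      also have "\<dots> = (\<Sum>p\<in>idx_upto K. 8 / 8 ^ fst p / (2 / 3) ^ fst p)"
        unfolding l_def \<kappa>_def lev_def by (rule reindex)
      also have "\<dots> = (\<Sum>m\<le>K. \<Sum>g\<in>grp m. 8 / 8 ^ m / (2 / 3) ^ m)"
        unfolding idx_upto_def by (subst sum.Sigma) (auto intro!: sum.cong)
      \<comment> \<open>\<open>8 * 4 ^ m\<close> rows, each contributing \<open>8 / 8 ^ m\<close> divided by \<open>(2 / 3) ^ m\<close>\<close>
      also have "\<dots> = (\<Sum>m\<le>K. 64 * (3 / 4) ^ m)"
      proof (rule sum.cong)
        fix m
        have "(4::real) ^ m / 8 ^ m / (2 / 3) ^ m = (3 / 4) ^ m"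
          unfolding power_divide[symmetric] by simp
        then show "(\<Sum>g\<in>grp m. 8 / 8 ^ m / (2 / 3) ^ m) = 64 * (3 / 4 :: real) ^ m"
          by (simp add: card_grp)
      qed simp
      also have "\<dots> = 64 * (\<Sum>m\<le>K. (3 / 4) ^ m)" by (simp add: sum_distrib_left)
      also have "\<dots> \<le> 64 * (\<Sum>m. (3 / 4) ^ m)"
        by (intro mult_left_mono sum_le_suminf summable_geometric) auto
      finally show "(\<Sum>i<n. l i / \<kappa> i) \<le> 64 * (\<Sum>m. (3 / 4) ^ m)" .
    qed
    show "(\<lambda>j. a i j * a j k) sums 0" for i k
    proof -
      let ?K = "Suc (Suc (lev i))"
      have "a i j = 0" if "j \<notin> F ?K" for j
        using that by (intro a0) (auto simp: F_def)
      then have "(\<lambda>j. a i j * a j k) sums (\<Sum>j\<in>F ?K. a i j * a j k)"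
        using fin by (intro sums_finite) auto
      also have "(\<Sum>j\<in>F ?K. a i j * a j k) = (\<Sum>h\<in>idx_upto ?K. davie_matrix (e i) h * davie_matrix h (e k))"
        unfolding a_def by (rule reindex)
      also have "\<dots> = 0" by (rule davie_matrix_square) (simp add: lev_def)
      finally show ?thesis .
    qed
    have diag: "a i i = (if i \<in> F 0 then 1 / 8 else 0)" for i
      unfolding a_def davie_matrix_diag[OF e_in] by (simp add: F_def lev_def)
    have "(\<lambda>i. a i i) sums (\<Sum>i\<in>F 0. a i i)"
      using fin diag by (intro sums_finite) auto
    also have "(\<Sum>i\<in>F 0. a i i) = real (card (F 0)) / 8" by (simp add: diag)
    also have "card (F 0) = card (idx_upto 0)" using bij by (rule bij_betw_same_card)
    also have "card (idx_upto 0) = 8" by (simp add: idx_upto_def card_grp)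
    finally show "(\<lambda>i. a i i) sums 1" by simp
  qed
qed

section \<open>The theorem\<close>

theorem theorem2p1:
  shows
    "(\<exists>(X :: (nat \<Rightarrow> real) set) N.
        banach_space_on seq_scale X N \<and> X \<noteq> {0} \<and>
        (\<exists>T \<in> normed_space_on.compact_operators seq_scale X N.
           T \<notin> normed_space_on.op_topology seq_scale X N
                 closure_of normed_space_on.NRA seq_scale X N)) \<or>
     (\<exists>(X :: (nat \<Rightarrow> complex) set) N.
        banach_space_on seq_scale X N \<and> X \<noteq> {0} \<and>
        (\<exists>T \<in> normed_space_on.compact_operators seq_scale X N.
           T \<notin> normed_space_on.op_topology seq_scale X N
                 closure_of normed_space_on.NRA seq_scale X N))"
proof -
  obtain a \<kappa> l where "square_zero_matrix a \<kappa> l" by (rule exists_square_zero_matrix)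
  then interpret square_zero_matrix a \<kappa> l .
  show ?thesis
    using banach_space_X X_nontrivial T_compact T_not_approximable by blast
qed

end
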